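(* Let $n,m\ge1$ and let $K$ be a uniformly non-degenerate bi-parameter full kernel on $\mathbb{R}^n\times\mathbb{R}^m$. There is a constant $C_0\ge 1$, depending only on $n$, $m$ and the kernel constants of $K$, such that if the relations $d(I,\tilde I)\sim\ell(I)$ and $d(J,\tilde J)\sim\ell(J)$ in the definition of $\Gamma$ are understood with comparability constant $C_0$, then the following holds. Let $k\ge1$ be an integer, let $b\in L^k_{\mathrm{loc}}(\mathbb{R}^{n+m})$ be real-valued, let $p\in(1,\infty)$, let $\mu,\lambda\in A_p(\mathbb{R}^n\times\mathbb{R}^m)$, and set $\nu=\mu^{1/p}\lambda^{-1/p}$. Then for $\Gamma=\Gamma(K,b,\mu,\lambda,k,p)$, $$ \|b\|_{\mathrm{bmo}(\nu^{1/k})}\le C\,\Gamma^{1/k}, $$ where the finite constant $C$ depends only on $n,m,p,k$, the kernel constants of $K$, $[\mu]_{A_p}$ and $[\lambda]_{A_p}$.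
   Context: **Setting.** Write $\mathbb{R}^{n+m}=\mathbb{R}^n\times\mathbb{R}^m$ and $x=(x_1,x_2)$ with $x_1\in\mathbb{R}^n$, $x_2\in\mathbb{R}^m$. A rectangle is a set $R=I\times J$ where $I\subset\mathbb{R}^n$, $J\subset\mathbb{R}^m$ are cubes with sides parallel to the axes; $\ell(I)$ is the side length of $I$ and $d(\cdot,\cdot)$ is the distance between sets. Write $\langle g\rangle_R=\frac1{|R|}\int_R g$ and $w(R)=\int_R w$. **Weights.** A weight is a locally integrable, a.e. positive function on $\mathbb{R}^{n+m}$. For $1<p<\infty$, $p'=p/(p-1)$, $w\in A_p(\mathbb{R}^n\times\mathbb{R}^m)$ means $[w]_{A_p}:=\sup_R\langle w\rangle_R\langle w^{1-p'}\rangle_R^{p-1}<\infty$, the supremum over all rectangles $R$. **Weighted little bmo.** For a weight $w$, $\|b\|_{\mathrm{bmo}(w)}:=\sup_R\frac1{w(R)}\int_R|b-\langle b\rangle_R|$, the supremum over all rectangles $R\subset\mathbb{R}^n\times\mathbb{R}^m$. **Bi-parameter full kernel.** A function $K:\{(x,y)\in\mathbb{R}^{n+m}\times\mathbb{R}^{n+m}: x_1\neq y_1,\ x_2\ne y_2\}\to\mathbb{C}$ is a standard bi-parameter full kernel if for some $\delta\in(0,1]$ and $C_K<\infty$: (i) Size: $|K(x,y)|\le C_K|x_1-y_1|^{-n}|x_2-y_2|^{-m}$. (ii) H\"older: whenever $|y_1-y_1'|\le|x_1-y_1|/2$ and $|y_2-y_2'|\le|x_2-y_2|/2$, $$|K(x,y)-K(x,(y_1,y_2'))-K(x,(y_1',y_2))+K(x,y')|\le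 C_K\frac{|y_1-y_1'|^\delta}{|x_1-y_1|^{n+\delta}}\frac{|y_2-y_2'|^\delta}{|x_2-y_2|^{m+\delta}},$$ and the analogous estimates hold when the pair of varied variables $(y_1,y_2)$ is replaced by $(x_1,x_2)$, $(x_1,y_2)$ or $(y_1,x_2)$. (iii) Mixed H\"older and size: whenever $|y_1-y_1'|\le|x_1-y_1|/2$, $$|K(x,y)-K(x,(y_1',y_2))|\le C_K\frac{|y_1-y_1'|^\delta}{|x_1-y_1|^{n+\delta}}\frac1{|x_2-y_2|^{m}},$$ and the analogous estimates hold when the single varied variable $y_1$ is replaced by $x_1$, $y_2$ or $x_2$ (with the roles of the two parameters interchanged for $x_2,y_2$). **Uniform non-degeneracy.** $K$ is uniformly non-degenerate if there is $c_K>0$ such that for all $y\in\mathbb{R}^{n+m}$ and $r_1,r_2>0$ there exists $x\in\mathbb{R}^{n+m}$ with $|x_1-y_1|>r_1$, $|x_2-y_2|>r_2$ and $|K(x,y)|\ge c_K\, r_1^{-n}r_2^{-m}$. The kernel constants of $K$ are $\delta,C_K,c_K$. **The constant $\Gamma$.** For integer $k\ge1$, real-valued $b\in L^k_{\mathrm{loc}}(\mathbb{R}^{n+m})$, $p>1$ and $\mu,\lambda\in A_p$, define $$\Gamma=\Gamma(K,b,\mu,\lambda,k,p)=\sup\frac1{\mu(R)^{1/p}}\Big\|x\mapsto1_{\tilde R}(x)\int_A(b(x)-b(y))^kK(x,y)\,dy\Big\|_{L^{p,\infty}(\lambda)}\in[0,\infty],$$ where the supremum is over all rectangles $R=I\times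 J$, $\tilde R=\tilde I\times\tilde J$ with $\ell(I)=\ell(\tilde I)$, $\ell(J)=\ell(\tilde J)$, $d(I,\tilde I)\sim\ell(I)$, $d(J,\tilde J)\sim\ell(J)$, and all measurable subsets $A\subset R$. Here $\|g\|_{L^{p,\infty}(\lambda)}=\sup_{t>0}t\,\lambda(\{|g|>t\})^{1/p}$, and $s\sim t$ with comparability constant $C_0$ means $C_0^{-1}t\le s\le C_0t$. *)

theory Defs
  imports "HOL-Analysis.Analysis"
begin

text \<open>
  The space \<open>(real^'n) \<times> (real^'m)\<close> plays the role of the product of Euclidean spaces of dimensions
  \<open>n = CARD('n)\<close> and \<open>m = CARD('m)\<close>; measurability and integrals refer to \<^const>\<open>lebesgue\<close>.
\<close>

text \<open>Only meant for exponents \<open>a > 0\<close>; infinity is mapped to infinity and \<open>0\<close> to \<open>0\<close>.\<close>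
definition ennpowr :: "ennreal \<Rightarrow> real \<Rightarrow> ennreal" where
  "ennpowr x a = (if x = \<infinity> then \<infinity> else ennreal (enn2real x powr a))"

definition cubes :: "real \<Rightarrow> (real^'n) set set" where
  "cubes l = {cbox a (a + vec l) | a. l > 0}"

definition rectangles :: "((real^'n) \<times> (real^'m)) set set" where
  "rectangles = {I \<times> J | I J. (\<exists>l. I \<in> cubes l) \<and> (\<exists>r. J \<in> cubes r)}"

text \<open>Averages of nonnegative functions take values in \<^typ>\<open>ennreal\<close>, so that non-integrability is
  recorded as infinity; averages of signed functions are Bochner integrals.\<close>
definition nn_average :: "('a::euclidean_space \<Rightarrow> real) \<Rightarrow> 'a set \<Rightarrow> ennreal" where
  "nn_average f R = (\<integral>\<^sup>+x\<in>R. ennreal (f x) \<partial>lebesgue) / emeasure lebesgue R"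

definition average :: "('a::euclidean_space \<Rightarrow> real) \<Rightarrow> 'a set \<Rightarrow> real" where
  "average f R = (LINT x:R|lebesgue. f x) / measure lebesgue R"

definition L_loc :: "nat \<Rightarrow> ('a::euclidean_space \<Rightarrow> real) \<Rightarrow> bool" where
  "L_loc k f \<longleftrightarrow> f \<in> borel_measurable lebesgue \<and>
     (\<forall>S. compact S \<longrightarrow> (\<lambda>x. \<bar>f x\<bar> ^ k) absolutely_integrable_on S)"

definition weight :: "('a::euclidean_space \<Rightarrow> real) \<Rightarrow> bool" where
  "weight w \<longleftrightarrow> L_loc 1 w \<and> (AE x in lebesgue. w x > 0)"

definition weight_measure :: "('a::euclidean_space \<Rightarrow> real) \<Rightarrow> 'a set \<Rightarrow> ennreal" where
  "weight_measure w E = (\<integral>\<^sup>+x\<in>E. ennreal (w x) \<partial>lebesgue)"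

text \<open>The exponent \<open>1 - p / (p - 1)\<close> is \<open>1 - p'\<close> for the conjugate exponent \<open>p'\<close> of \<open>p\<close>.\<close>
definition Ap_char :: "real \<Rightarrow> ((real^'n) \<times> (real^'m) \<Rightarrow> real) \<Rightarrow> ennreal" where
  "Ap_char p w = (SUP R\<in>rectangles.
     nn_average w R * ennpowr (nn_average (\<lambda>x. w x powr (1 - p / (p - 1))) R) (p - 1))"

definition Ap :: "real \<Rightarrow> ((real^'n) \<times> (real^'m) \<Rightarrow> real) set" where
  "Ap p = {w. weight w \<and> Ap_char p w < \<infinity>}"

definition bmo_norm ::
  "((real^'n) \<times> (real^'m) \<Rightarrow> real) \<Rightarrow> ((real^'n) \<times> (real^'m) \<Rightarrow> real) \<Rightarrow> ennreal" where
  "bmo_norm w b = (SUP R\<in>rectangles.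
     (\<integral>\<^sup>+x\<in>R. ennreal \<bar>b x - average b R\<bar> \<partial>lebesgue) / weight_measure w R)"

text \<open>Kernels are total functions here, but they are only ever constrained, and only ever evaluated
  in the quantities below, at pairs of points which differ in both components.\<close>

definition size_bound :: "nat \<Rightarrow> real \<Rightarrow> real" where
  "size_bound d r = 1 / r ^ d"

definition hoelder_bound :: "nat \<Rightarrow> real \<Rightarrow> real \<Rightarrow> real \<Rightarrow> real" where
  "hoelder_bound d \<delta> h r = h powr \<delta> / r powr (real d + \<delta>)"

definition kernel_size ::
  "real \<Rightarrow> ((real^'n) \<times> (real^'m) \<Rightarrow> (real^'n) \<times> (real^'m) \<Rightarrow> complex) \<Rightarrow> bool" where
  "kernel_size CK K \<longleftrightarrow> (\<forall>x1 x2 y1 y2. x1 \<noteq> y1 \<longrightarrow> x2 \<noteq> y2 \<longrightarrow>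
     norm (K (x1, x2) (y1, y2))
       \<le> CK * size_bound CARD('n) (norm (x1 - y1)) * size_bound CARD('m) (norm (x2 - y2)))"

definition kernel_hoelder ::
  "real \<Rightarrow> real \<Rightarrow> ((real^'n) \<times> (real^'m) \<Rightarrow> (real^'n) \<times> (real^'m) \<Rightarrow> complex) \<Rightarrow> bool" where
  "kernel_hoelder \<delta> CK K \<longleftrightarrow> (\<forall>x1 x2 y1 y2. x1 \<noteq> y1 \<longrightarrow> x2 \<noteq> y2 \<longrightarrow>
     (\<forall>y1' y2'. norm (y1 - y1') \<le> norm (x1 - y1) / 2 \<longrightarrow> norm (y2 - y2') \<le> norm (x2 - y2) / 2 \<longrightarrow>
        norm (K (x1, x2) (y1, y2) - K (x1, x2) (y1, y2')
              - K (x1, x2) (y1', y2) + K (x1, x2) (y1', y2'))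
        \<le> CK * hoelder_bound CARD('n) \<delta> (norm (y1 - y1')) (norm (x1 - y1))
             * hoelder_bound CARD('m) \<delta> (norm (y2 - y2')) (norm (x2 - y2))) \<and>
     (\<forall>x1' x2'. norm (x1 - x1') \<le> norm (x1 - y1) / 2 \<longrightarrow> norm (x2 - x2') \<le> norm (x2 - y2) / 2 \<longrightarrow>
        norm (K (x1, x2) (y1, y2) - K (x1, x2') (y1, y2)
              - K (x1', x2) (y1, y2) + K (x1', x2') (y1, y2))
        \<le> CK * hoelder_bound CARD('n) \<delta> (norm (x1 - x1')) (norm (x1 - y1))
             * hoelder_bound CARD('m) \<delta> (norm (x2 - x2')) (norm (x2 - y2))) \<and>
     (\<forall>x1' y2'. norm (x1 - x1') \<le> norm (x1 - y1) / 2 \<longrightarrow> norm (y2 - y2') \<le> norm (x2 - y2) / 2 \<longrightarrow>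
        norm (K (x1, x2) (y1, y2) - K (x1, x2) (y1, y2')
              - K (x1', x2) (y1, y2) + K (x1', x2) (y1, y2'))
        \<le> CK * hoelder_bound CARD('n) \<delta> (norm (x1 - x1')) (norm (x1 - y1))
             * hoelder_bound CARD('m) \<delta> (norm (y2 - y2')) (norm (x2 - y2))) \<and>
     (\<forall>y1' x2'. norm (y1 - y1') \<le> norm (x1 - y1) / 2 \<longrightarrow> norm (x2 - x2') \<le> norm (x2 - y2) / 2 \<longrightarrow>
        norm (K (x1, x2) (y1, y2) - K (x1, x2') (y1, y2)
              - K (x1, x2) (y1', y2) + K (x1, x2') (y1', y2))
        \<le> CK * hoelder_bound CARD('n) \<delta> (norm (y1 - y1')) (norm (x1 - y1))
             * hoelder_bound CARD('m) \<delta> (norm (x2 - x2')) (norm (x2 - y2))))"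

definition kernel_mixed ::
  "real \<Rightarrow> real \<Rightarrow> ((real^'n) \<times> (real^'m) \<Rightarrow> (real^'n) \<times> (real^'m) \<Rightarrow> complex) \<Rightarrow> bool" where
  "kernel_mixed \<delta> CK K \<longleftrightarrow> (\<forall>x1 x2 y1 y2. x1 \<noteq> y1 \<longrightarrow> x2 \<noteq> y2 \<longrightarrow>
     (\<forall>y1'. norm (y1 - y1') \<le> norm (x1 - y1) / 2 \<longrightarrow>
        norm (K (x1, x2) (y1, y2) - K (x1, x2) (y1', y2))
        \<le> CK * hoelder_bound CARD('n) \<delta> (norm (y1 - y1')) (norm (x1 - y1))
             * size_bound CARD('m) (norm (x2 - y2))) \<and>
     (\<forall>x1'. norm (x1 - x1') \<le> norm (x1 - y1) / 2 \<longrightarrow>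
        norm (K (x1, x2) (y1, y2) - K (x1', x2) (y1, y2))
        \<le> CK * hoelder_bound CARD('n) \<delta> (norm (x1 - x1')) (norm (x1 - y1))
             * size_bound CARD('m) (norm (x2 - y2))) \<and>
     (\<forall>y2'. norm (y2 - y2') \<le> norm (x2 - y2) / 2 \<longrightarrow>
        norm (K (x1, x2) (y1, y2) - K (x1, x2) (y1, y2'))
        \<le> CK * size_bound CARD('n) (norm (x1 - y1))
             * hoelder_bound CARD('m) \<delta> (norm (y2 - y2')) (norm (x2 - y2))) \<and>
     (\<forall>x2'. norm (x2 - x2') \<le> norm (x2 - y2) / 2 \<longrightarrow>
        norm (K (x1, x2) (y1, y2) - K (x1, x2') (y1, y2))
        \<le> CK * size_bound CARD('n) (norm (x1 - y1))
             * hoelder_bound CARD('m) \<delta> (norm (x2 - x2')) (norm (x2 - y2))))"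

definition full_kernel ::
  "real \<Rightarrow> real \<Rightarrow> ((real^'n) \<times> (real^'m) \<Rightarrow> (real^'n) \<times> (real^'m) \<Rightarrow> complex) \<Rightarrow> bool" where
  "full_kernel \<delta> CK K \<longleftrightarrow>
     0 < \<delta> \<and> \<delta> \<le> 1 \<and> kernel_size CK K \<and> kernel_hoelder \<delta> CK K \<and> kernel_mixed \<delta> CK K"

definition uniformly_nondegenerate ::
  "real \<Rightarrow> ((real^'n) \<times> (real^'m) \<Rightarrow> (real^'n) \<times> (real^'m) \<Rightarrow> complex) \<Rightarrow> bool" where
  "uniformly_nondegenerate cK K \<longleftrightarrow> cK > 0 \<and>
     (\<forall>y1 y2. \<forall>r1>0. \<forall>r2>0. \<exists>x1 x2. norm (x1 - y1) > r1 \<and> norm (x2 - y2) > r2 \<and>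
        norm (K (x1, x2) (y1, y2)) \<ge> cK * size_bound CARD('n) r1 * size_bound CARD('m) r2)"

definition weak_norm ::
  "real \<Rightarrow> ('a::euclidean_space \<Rightarrow> real) \<Rightarrow> ('a \<Rightarrow> complex) \<Rightarrow> ennreal" where
  "weak_norm p w g = (SUP t\<in>{0<..}. ennreal t * ennpowr (weight_measure w {x. norm (g x) > t}) (1 / p))"

definition comparable :: "real \<Rightarrow> real \<Rightarrow> real \<Rightarrow> bool" where
  "comparable C s t \<longleftrightarrow> t / C \<le> s \<and> s \<le> C * t"

text \<open>Here \<open>I'\<close> and \<open>J'\<close> are the displaced cubes; by the distance conditions, \<open>I\<close> and \<open>I'\<close> as well as
  \<open>J\<close> and \<open>J'\<close> are at a positive distance, so the kernel is never evaluated on the diagonal.\<close>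
definition Gamma_const ::
  "real \<Rightarrow> ((real^'n) \<times> (real^'m) \<Rightarrow> (real^'n) \<times> (real^'m) \<Rightarrow> complex) \<Rightarrow>
   ((real^'n) \<times> (real^'m) \<Rightarrow> real) \<Rightarrow> ((real^'n) \<times> (real^'m) \<Rightarrow> real) \<Rightarrow>
   ((real^'n) \<times> (real^'m) \<Rightarrow> real) \<Rightarrow> nat \<Rightarrow> real \<Rightarrow> ennreal" where
  "Gamma_const C0 K b \<mu> lam k p = Sup
     {weak_norm p lam
        (\<lambda>x. indicator (I' \<times> J') x * (LINT y:A|lebesgue. complex_of_real ((b x - b y) ^ k) * K x y))
        / ennpowr (weight_measure \<mu> (I \<times> J)) (1 / p)
      | I J I' J' A. \<exists>l r. I \<in> cubes l \<and> I' \<in> cubes l \<and> J \<in> cubes r \<and> J' \<in> cubes r \<and>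
          comparable C0 (setdist I I') l \<and> comparable C0 (setdist J J') r \<and>
          A \<in> sets lebesgue \<and> A \<subseteq> I \<times> J}"

end

theory Submission
  imports Defs
begin

text \<open>
  The proof is the median method. Fix a rectangle \<open>R = I \<times> J\<close>. Non-degeneracy, applied at a corner of
  \<open>R\<close> with radii a large multiple \<open>A\<close> of the side lengths, produces a point at which the kernel is as
  large as the size bound allows; the size bound in turn keeps this point within a fixed multiple of
  the side lengths of \<open>R\<close>. Let \<open>R'\<close> be the translate of \<open>R\<close> with its corner at this point. The mixed
  Hoelder estimates, used in one variable at a time, show that on \<open>R' \<times> R\<close> the kernel differs from a
  constant \<open>\<kappa>\<close> with \<open>|\<kappa>| \<ge> c / |R|\<close> by at most \<open>|\<kappa>| / 2\<close>, once \<open>A\<close> is large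
  (\<open>nondegenerate_companion\<close>).

  Let \<open>\<alpha>\<close> be a median of \<open>b\<close> on \<open>R'\<close>. If \<open>b x \<ge> \<alpha>\<close> and \<open>y\<close> ranges over \<open>Y = {y \<in> R. b y \<le> \<alpha>}\<close>, then
  \<open>(b x - b y)^k \<ge> (\<alpha> - b y)^k \<ge> 0\<close>, so nothing cancels in the commutator integral and its modulus
  is at least \<open>|\<kappa>| / 2\<close> times the integral of \<open>(\<alpha> - b)^k\<close> over \<open>Y\<close>. This holds on the set
  \<open>{x \<in> R'. b x \<ge> \<alpha>}\<close>, which fills half of \<open>R'\<close> and therefore, by the \<open>A\<^sub>p\<close> condition on a rectangle
  containing \<open>R\<close> and \<open>R'\<close>, has \<open>\<lambda>\<close>-measure comparable to that of \<open>R\<close> (\<open>Ap_subset_bound\<close>). Inserting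
  this into the weak-type quantity, exchanging the roles of \<open>\<le>\<close> and \<open>\<ge>\<close>, and adding up gives
  \<open>\<integral>\<^sub>R |b - \<alpha>|^k \<le> C \<Gamma> |R| (\<mu>(R) / \<lambda>(R))^(1/p)\<close> (\<open>power_oscillation_bound\<close>).

  The power mean inequality turns this into a bound for \<open>\<integral>\<^sub>R |b - \<alpha>|\<close>, which controls the
  oscillation around the average up to a factor 2. What remains is the weight inequality
  \<open>|R| (\<mu>(R) / \<lambda>(R))^(1/(pk)) \<le> C \<integral>\<^sub>R \<nu>^(1/k)\<close>; it follows from Hoelder's inequality with three factors
  \<open>\<nu>^(1/k)\<close>, \<open>\<mu>^(-1/(p-1))\<close>, \<open>\<lambda>\<close> whose weighted product is 1, together with the \<open>A\<^sub>p\<close> condition for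
  \<open>\<mu>\<close> (\<open>Ap_bloom_ratio_bound\<close>).
\<close>

section \<open>Hoelder's inequality for three functions\<close>

text \<open>Concavity of the logarithm, in the form \<open>ln t \<le> t - 1\<close> applied to each variable divided by the
  weighted arithmetic mean.\<close>
lemma weighted_am_gm3:
  fixes a b c x y z :: real
  assumes "a \<ge> 0" "b \<ge> 0" "c \<ge> 0" "a + b + c = 1" "x \<ge> 0" "y \<ge> 0" "z \<ge> 0"
  shows "x powr a * y powr b * z powr c \<le> a * x + b * y + c * z"
proof (cases "x = 0 \<or> y = 0 \<or> z = 0")
  case True
  then show ?thesis using assms by auto
next
  case False
  then have pos: "x > 0" "y > 0" "z > 0" using assms by auto
  define s where "s = a * x + b * y + c * z"
  have "a > 0 \<or> b > 0 \<or> c > 0" using assms(4) assms(1-3) by linarith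
  then have s: "s > 0" unfolding s_def using pos assms
    by (smt (verit) mult_nonneg_nonneg mult_pos_pos)
  have l: "ln t \<le> ln s + t / s - 1" if "t > 0" for t
    using ln_le_minus_one[of "t / s"] that s by (simp add: ln_div)
  have "a * ln x + b * ln y + c * ln z
      \<le> a * (ln s + x / s - 1) + b * (ln s + y / s - 1) + c * (ln s + z / s - 1)"
    using l pos assms by (intro add_mono mult_left_mono) auto
  also have "\<dots> = (a + b + c) * (ln s - 1) + s / s"
    using s by (simp add: s_def[symmetric] field_simps) (simp add: s_def algebra_simps)
  also have "\<dots> = ln s" using s assms(4) by simp
  finally have "exp (a * ln x + b * ln y + c * ln z) \<le> exp (ln s)" by simp
  then show ?thesis using pos s by (simp add: powr_def exp_add s_def)
qed

text \<open>Normalise each function by its bound and integrate the pointwise inequality of weighted means.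
  Taking \<open>c = 0\<close> with \<open>h\<close> one of the other two functions gives the usual inequality for two
  functions.\<close>
lemma nn_integral_Hoelder3:
  fixes f g h :: "'a \<Rightarrow> real"
  assumes meas: "f \<in> borel_measurable M" "g \<in> borel_measurable M" "h \<in> borel_measurable M"
    and nonneg: "\<And>x. f x \<ge> 0" "\<And>x. g x \<ge> 0" "\<And>x. h x \<ge> 0"
    and "a \<ge> 0" "b \<ge> 0" "c \<ge> 0" "a + b + c = 1"
    and pos: "F > 0" "G > 0" "H > 0"
    and le: "(\<integral>\<^sup>+x. ennreal (f x) \<partial>M) \<le> ennreal F" "(\<integral>\<^sup>+x. ennreal (g x) \<partial>M) \<le> ennreal G"
      "(\<integral>\<^sup>+x. ennreal (h x) \<partial>M) \<le> ennreal H"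
  shows "(\<integral>\<^sup>+x. ennreal (f x powr a * g x powr b * h x powr c) \<partial>M)
    \<le> ennreal (F powr a * G powr b * H powr c)"
proof -
  define P where "P = F powr a * G powr b * H powr c"
  have P: "P > 0" unfolding P_def using pos by simp
  have "(\<integral>\<^sup>+x. ennreal (f x powr a * g x powr b * h x powr c) \<partial>M)
     \<le> (\<integral>\<^sup>+x. ennreal (P * a / F) * ennreal (f x) + ennreal (P * b / G) * ennreal (g x)
         + ennreal (P * c / H) * ennreal (h x) \<partial>M)"
  proof (rule nn_integral_mono)
    fix x
    have "f x powr a * g x powr b * h x powr c
        = P * ((f x / F) powr a * (g x / G) powr b * (h x / H) powr c)"
      unfolding P_def using pos nonneg by (simp add: powr_divide)
    also have "\<dots> \<le> P * (a * (f x / F) + b * (g x / G) + c * (h x / H))"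
      using P assms by (intro mult_left_mono weighted_am_gm3) auto
    also have "\<dots> = P * a / F * f x + P * b / G * g x + P * c / H * h x"
      by (simp add: algebra_simps)
    finally show "ennreal (f x powr a * g x powr b * h x powr c) \<le> ennreal (P * a / F) * ennreal (f x)
      + ennreal (P * b / G) * ennreal (g x) + ennreal (P * c / H) * ennreal (h x)"
      using P assms by (simp flip: ennreal_mult ennreal_plus add: ennreal_leI)
  qed
  also have "\<dots> = ennreal (P * a / F) * (\<integral>\<^sup>+x. ennreal (f x) \<partial>M)
      + ennreal (P * b / G) * (\<integral>\<^sup>+x. ennreal (g x) \<partial>M)
      + ennreal (P * c / H) * (\<integral>\<^sup>+x. ennreal (h x) \<partial>M)"
    using meas by (simp add: nn_integral_add nn_integral_cmult)
  also have "\<dots> \<le> ennreal (P * a / F) * ennreal F + ennreal (P * b / G) * ennreal G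
      + ennreal (P * c / H) * ennreal H"
    using le by (intro add_mono mult_left_mono) auto
  also have "\<dots> = ennreal (P * (a + b + c))"
    using P assms(7-9) pos by (simp flip: ennreal_mult ennreal_plus add: distrib_left)
  finally show ?thesis using assms(10) by (simp add: P_def)
qed

lemma set_nn_integral_power_mean:
  fixes f :: "'a::euclidean_space \<Rightarrow> real" and k :: nat
  assumes f: "f \<in> borel_measurable lebesgue" "\<And>x. f x \<ge> 0" and k: "k \<ge> 1"
    and R: "R \<in> sets lebesgue" "emeasure lebesgue R = ennreal m" "m > 0"
    and le: "(\<integral>\<^sup>+x\<in>R. ennreal (f x ^ k) \<partial>lebesgue) \<le> ennreal F" "F \<ge> 0"
  shows "(\<integral>\<^sup>+x\<in>R. ennreal (f x) \<partial>lebesgue) \<le> ennreal (F powr (1 / real k) * m powr (1 - 1 / real k))"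
proof (cases "F = 0")
  case True
  have "AE x in lebesgue. ennreal (f x ^ k) * indicator R x = 0"
    using le(1) f R True by (subst nn_integral_0_iff_AE[symmetric]) auto
  then have "AE x in lebesgue. ennreal (f x) * indicator R x = 0"
  proof eventually_elim
    case (elim x)
    then show ?case using f(2)[of x] by (auto split: split_indicator_asm simp: power_le_zero_eq)
  qed
  then have "(\<integral>\<^sup>+x\<in>R. ennreal (f x) \<partial>lebesgue) = 0"
    using f R by (subst nn_integral_0_iff_AE) auto
  then show ?thesis by simp
next
  case False
  then have F: "F > 0" using le by simp
  define g where "g x = f x ^ k * indicator R x" for x
  define h where "h x = (indicator R x :: real)" for x
  have "(\<integral>\<^sup>+x\<in>R. ennreal (f x) \<partial>lebesgue) 
    = (\<integral>\<^sup>+x. ennreal (g x powr (1 / real k) * h x powr (1 - 1 / real k) * h x powr 0) \<partial>lebesgue)"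
  proof (intro nn_integral_cong)
    fix x
    have "(f x ^ k) powr (1 / real k) = f x"
      using k f(2)[of x] by (cases "f x = 0") (auto simp: powr_powr simp flip: powr_realpow)
    then show "ennreal (f x) * indicator R x = ennreal (g x powr (1 / real k) * h x powr (1 - 1 / real k) * h x powr 0)"
      by (auto simp: g_def h_def split: split_indicator)
  qed
  also have "\<dots> \<le> ennreal (F powr (1 / real k) * m powr (1 - 1 / real k) * m powr 0)"
  proof (rule nn_integral_Hoelder3)
    have "(\<integral>\<^sup>+x. ennreal (g x) \<partial>lebesgue) = (\<integral>\<^sup>+x\<in>R. ennreal (f x ^ k) \<partial>lebesgue)"
      unfolding g_def by (intro nn_integral_cong) (auto split: split_indicator)
    then show "(\<integral>\<^sup>+x. ennreal (g x) \<partial>lebesgue) \<le> ennreal F" using le by simp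
    have "(\<integral>\<^sup>+x. ennreal (h x) \<partial>lebesgue) = emeasure lebesgue R"
      unfolding h_def using R by (simp add: ennreal_indicator)
    then show "(\<integral>\<^sup>+x. ennreal (h x) \<partial>lebesgue) \<le> ennreal m" "(\<integral>\<^sup>+x. ennreal (h x) \<partial>lebesgue) \<le> ennreal m"
      using R by auto
    show "g \<in> borel_measurable lebesgue" "h \<in> borel_measurable lebesgue" "h \<in> borel_measurable lebesgue"
      unfolding g_def h_def using f R by auto
  qed (use k f F R in \<open>auto simp: g_def h_def\<close>)
  finally show ?thesis using R by simp
qed

section \<open>Medians and mean oscillation\<close>

text \<open>The value \<open>\<alpha>\<close> is the infimum of all \<open>t\<close> for which \<open>{b \<le> t}\<close> has at least half of the measure.
  Continuity of the measure from above gives the first inequality, and continuity from below gives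
  measure at most one half to \<open>{b < \<alpha>}\<close>, hence the second.\<close>
lemma ex_median:
  fixes b :: "'a \<Rightarrow> real"
  assumes S: "S \<in> fmeasurable M" and b: "b \<in> borel_measurable M"
  obtains \<alpha> where "measure M S / 2 \<le> measure M {x \<in> S. b x \<le> \<alpha>}"
    "measure M S / 2 \<le> measure M {x \<in> S. \<alpha> \<le> b x}"
proof (cases "measure M S = 0")
  case True
  then show ?thesis by (intro that[of 0]) auto
next
  case False
  then have pos: "measure M S > 0" by (simp add: zero_less_measure_iff)
  have [measurable]: "S \<in> sets M" "b \<in> borel_measurable M" using assms by (auto simp: fmeasurable_def)
  have Ssp: "S \<subseteq> space M" using sets.sets_into_space[of S M] by simp
  have eq: "{x \<in> S. P x} = S \<inter> {x \<in> space M. P x}" for P using Ssp by auto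
  have meas [measurable]: "{x \<in> S. b x \<le> t} \<in> sets M" "{x \<in> S. t \<le> b x} \<in> sets M" "{x \<in> S. b x < t} \<in> sets M" for t
    unfolding eq by measurable
  have fin: "emeasure M A \<noteq> \<infinity>" if "A \<subseteq> S" "A \<in> sets M" for A
    using emeasure_mono[OF that(1), of M] S by (auto simp: fmeasurable_def top_unique)
  have fm: "A \<in> fmeasurable M" if "A \<subseteq> S" "A \<in> sets M" for A
    using fin[OF that] that by (auto simp: fmeasurable_def less_top)
  define F where "F t = measure M {x \<in> S. b x \<le> t}" for t
  have Fmono: "F s \<le> F t" if "s \<le> t" for s t
    unfolding F_def using that by (intro measure_mono_fmeasurable fm) auto
  define H where "H = {t. measure M S / 2 \<le> F t}"
  have "(\<lambda>n. F (real n)) \<longlonglongrightarrow> measure M (\<Union>n. {x \<in> S. b x \<le> real n})"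
    unfolding F_def
  proof (rule Lim_measure_incseq)
    show "emeasure M (\<Union>n. {x \<in> S. b x \<le> real n}) \<noteq> \<infinity>" by (rule fin) auto
  qed (auto simp: incseq_def)
  also have "(\<Union>n. {x \<in> S. b x \<le> real n}) = S" using real_arch_simple by auto
  finally have "\<forall>\<^sub>F n in sequentially. F (real n) > measure M S / 2"
    using pos by (intro order_tendstoD(1)) auto
  then obtain n where "F (real n) > measure M S / 2" by (auto simp: eventually_sequentially)
  then have ne: "H \<noteq> {}" by (auto simp: H_def intro!: exI[of _ "real n"])
  have "(\<lambda>n. F (- real n)) \<longlonglongrightarrow> measure M (\<Inter>n. {x \<in> S. b x \<le> - real n})"
    unfolding F_def
  proof (rule Lim_measure_decseq)
    show "emeasure M {x \<in> S. b x \<le> - real n} \<noteq> \<infinity>" for n by (rule fin) auto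
  qed (auto simp: decseq_def)
  also have "(\<Inter>n. {x \<in> S. b x \<le> - real n}) = {}"
  proof -
    have "\<exists>n. \<not> b x \<le> - real n" for x 
    proof -
      obtain n where "- b x < real n" using reals_Archimedean2[of "- b x"] by blast
      then show ?thesis by (intro exI[of _ n]) auto
    qed
    then show ?thesis by blast
  qed
  finally have "\<forall>\<^sub>F n in sequentially. F (- real n) < measure M S / 2"
    using pos by (intro order_tendstoD(2)) auto
  then obtain n' where "F (- real n') < measure M S / 2" by (auto simp: eventually_sequentially)
  then have lower: "- real n' \<le> t" if "t \<in> H" for t
    using that Fmono[of t "- real n'"] by (fastforce simp: H_def)
  then have bdd: "bdd_below H" by (auto simp: bdd_below_def)
  define \<alpha> where "\<alpha> = Inf H"
  have above: "measure M S / 2 \<le> F t" if t: "t > \<alpha>" for t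
  proof -
    obtain s where "s \<in> H" "s < t" using t cInf_less_iff[OF ne bdd] by (auto simp: \<alpha>_def)
    then show ?thesis using Fmono[of s t] by (auto simp: H_def)
  qed
  have below: "F t < measure M S / 2" if "t < \<alpha>" for t
    using that cInf_lower[OF _ bdd, of t] by (auto simp: \<alpha>_def H_def not_le[symmetric])
  have "(\<lambda>n. F (\<alpha> + 1 / real (Suc n))) \<longlonglongrightarrow> measure M (\<Inter>n. {x \<in> S. b x \<le> \<alpha> + 1 / real (Suc n)})"
    unfolding F_def
  proof (rule Lim_measure_decseq)
    show "emeasure M {x \<in> S. b x \<le> \<alpha> + 1 / real (Suc n)} \<noteq> \<infinity>" for n by (rule fin) auto
    show "decseq (\<lambda>n. {x \<in> S. b x \<le> \<alpha> + 1 / real (Suc n)})"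
    proof (intro decseq_SucI subsetI)
      fix n :: nat and x assume "x \<in> {x \<in> S. b x \<le> \<alpha> + 1 / real (Suc (Suc n))}"
      moreover have "1 / real (Suc (Suc n)) \<le> 1 / real (Suc n)" by (intro frac_le) auto
      ultimately show "x \<in> {x \<in> S. b x \<le> \<alpha> + 1 / real (Suc n)}" by auto
    qed
  qed auto
  also have "(\<Inter>n. {x \<in> S. b x \<le> \<alpha> + 1 / real (Suc n)}) = {x \<in> S. b x \<le> \<alpha>}"
  proof -
    have "b x \<le> \<alpha>" if "\<And>n. b x \<le> \<alpha> + 1 / real (Suc n)" for x
    proof (rule ccontr)
      assume "\<not> b x \<le> \<alpha>"
      then have "0 < b x - \<alpha>" by simp
      then obtain n where "inverse (real (Suc n)) < b x - \<alpha>" using reals_Archimedean by blast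
      moreover have "b x \<le> \<alpha> + inverse (real (Suc n))" using that[of n] unfolding inverse_eq_divide .
      ultimately show False by linarith
    qed
    moreover have "b x \<le> \<alpha> + 1 / real (Suc n)" if "b x \<le> \<alpha>" for x n
      using that by (rule order_trans) simp
    ultimately show ?thesis by blast
  qed
  finally have A: "measure M S / 2 \<le> measure M {x \<in> S. b x \<le> \<alpha>}"
    by (rule LIMSEQ_le_const) (intro exI[of _ 0] allI impI above, simp)
  have "(\<lambda>n. F (\<alpha> - 1 / real (Suc n))) \<longlonglongrightarrow> measure M (\<Union>n. {x \<in> S. b x \<le> \<alpha> - 1 / real (Suc n)})"
    unfolding F_def
  proof (rule Lim_measure_incseq)
    show "emeasure M (\<Union>n. {x \<in> S. b x \<le> \<alpha> - 1 / real (Suc n)}) \<noteq> \<infinity>" by (rule fin) auto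
    show "incseq (\<lambda>n. {x \<in> S. b x \<le> \<alpha> - 1 / real (Suc n)})"
    proof (intro incseq_SucI subsetI)
      fix n :: nat and x assume "x \<in> {x \<in> S. b x \<le> \<alpha> - 1 / real (Suc n)}"
      moreover have "1 / real (Suc (Suc n)) \<le> 1 / real (Suc n)" by (intro frac_le) auto
      ultimately show "x \<in> {x \<in> S. b x \<le> \<alpha> - 1 / real (Suc (Suc n))}" by auto
    qed
  qed auto
  also have "(\<Union>n. {x \<in> S. b x \<le> \<alpha> - 1 / real (Suc n)}) = {x \<in> S. b x < \<alpha>}"
  proof -
    have "\<exists>n. b x \<le> \<alpha> - 1 / real (Suc n)" if bx: "b x < \<alpha>" for x
    proof -
      obtain n where "inverse (real (Suc n)) < \<alpha> - b x" using reals_Archimedean[of "\<alpha> - b x"] bx by auto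
      then show ?thesis by (intro exI[of _ n]) (simp add: inverse_eq_divide)
    qed
    moreover have "b x < \<alpha>" if "b x \<le> \<alpha> - 1 / real (Suc n)" for x n
      using that by (rule le_less_trans) simp
    ultimately show ?thesis by blast
  qed
  finally have B: "measure M {x \<in> S. b x < \<alpha>} \<le> measure M S / 2"
    by (rule LIMSEQ_le_const2) (intro exI[of _ 0] allI impI less_imp_le below, simp)
  have "measure M S = measure M ({x \<in> S. b x < \<alpha>} \<union> {x \<in> S. \<alpha> \<le> b x})"
    by (rule arg_cong[of _ _ "measure M"]) auto
  also have "\<dots> = measure M {x \<in> S. b x < \<alpha>} + measure M {x \<in> S. \<alpha> \<le> b x}"
    using meas fin by (intro measure_Union) auto
  finally have "measure M S / 2 \<le> measure M {x \<in> S. \<alpha> \<le> b x}" using B by linarith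
  with A show ?thesis by (rule that)
qed

text \<open>The average minimises the mean oscillation up to a factor 2, so that any convenient constant
  \<open>\<alpha>\<close>, here a median over another rectangle, may replace it.\<close>
lemma mean_oscillation_le:
  fixes b :: "'a::euclidean_space \<Rightarrow> real"
  assumes b: "b \<in> borel_measurable lebesgue"
    and R: "R \<in> sets lebesgue" "emeasure lebesgue R = ennreal m" "m > 0"
    and le: "(\<integral>\<^sup>+x\<in>R. ennreal \<bar>b x - \<alpha>\<bar> \<partial>lebesgue) \<le> ennreal T" "T \<ge> 0"
  shows "(\<integral>\<^sup>+x\<in>R. ennreal \<bar>b x - average b R\<bar> \<partial>lebesgue) \<le> ennreal (2 * T)"
proof -
  note b[measurable] R(1)[measurable]
  define f where "f x = indicator R x * (b x - \<alpha>)" for x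
  have [measurable]: "f \<in> borel_measurable lebesgue" unfolding f_def by measurable
  have nf: "(\<integral>\<^sup>+x. ennreal (norm (f x)) \<partial>lebesgue) = (\<integral>\<^sup>+x\<in>R. ennreal \<bar>b x - \<alpha>\<bar> \<partial>lebesgue)"
    by (intro nn_integral_cong) (auto simp: f_def split: split_indicator)
  have f: "integrable lebesgue f"
    unfolding integrable_iff_bounded nf using le(1) by (auto intro: le_less_trans)
  have ind: "integrable lebesgue (\<lambda>x. indicator R x * \<alpha>)"
    using R by (intro integrable_mult_left) (auto simp: integrable_indicator_iff)
  have mR: "measure lebesgue R = m" using R by (simp add: measure_def)
  have "(LINT x:R|lebesgue. b x) = (LINT x|lebesgue. f x + indicator R x * \<alpha>)"
    unfolding set_lebesgue_integral_def f_def by (simp add: algebra_simps)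
  also have "\<dots> = (LINT x|lebesgue. f x) + m * \<alpha>"
    using f ind by (simp add: mR)
  finally have "average b R - \<alpha> = (LINT x|lebesgue. f x) / m"
    using R by (simp add: average_def mR field_simps)
  moreover have "\<bar>LINT x|lebesgue. f x\<bar> \<le> T"
  proof -
    have "ennreal (LINT x|lebesgue. norm (f x)) \<le> ennreal T"
      using f le(1) nf by (subst nn_integral_eq_integral[symmetric]) auto
    then have "(LINT x|lebesgue. norm (f x)) \<le> T" using le(2) by (simp add: ennreal_le_iff)
    then show ?thesis using integral_norm_bound[of lebesgue f] unfolding real_norm_def by linarith
  qed
  ultimately have av: "\<bar>average b R - \<alpha>\<bar> * m \<le> T" using R by simp
  have "(\<integral>\<^sup>+x\<in>R. ennreal \<bar>b x - average b R\<bar> \<partial>lebesgue)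
     \<le> (\<integral>\<^sup>+x. ennreal \<bar>b x - \<alpha>\<bar> * indicator R x + ennreal \<bar>average b R - \<alpha>\<bar> * indicator R x \<partial>lebesgue)"
    by (intro nn_integral_mono) (auto split: split_indicator simp flip: ennreal_plus intro!: ennreal_leI)
  also have "\<dots> = (\<integral>\<^sup>+x\<in>R. ennreal \<bar>b x - \<alpha>\<bar> \<partial>lebesgue) + ennreal \<bar>average b R - \<alpha>\<bar> * emeasure lebesgue R"
    by (subst nn_integral_add) (auto simp: nn_integral_cmult_indicator)
  also have "\<dots> \<le> ennreal T + ennreal T"
    using le av R by (intro add_mono) (auto simp flip: ennreal_mult intro!: ennreal_leI)
  also have "\<dots> = ennreal (2 * T)" using le by (simp flip: ennreal_plus)
  finally show ?thesis .
qed

section \<open>Cubes and rectangles\<close>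

lemma measure_rectangle:
  fixes a :: "real^'n" and b :: "real^'m"
  assumes "l > 0" "r > 0"
  shows "measure lebesgue (cbox a (a + vec l) \<times> cbox b (b + vec r)) = l ^ CARD('n) * r ^ CARD('m)"
proof -
  have "cbox a (a + vec l) \<times> cbox b (b + vec r) = cbox (a, b) (a + vec l, b + vec r)"
    by (rule cbox_Pair_eq[symmetric])
  moreover have "measure lebesgue (cbox (a, b) (a + vec l, b + vec r))
    = measure lborel (cbox a (a + vec l)) * measure lborel (cbox b (b + vec r))"
    by (simp add: content_Pair)
  moreover have "measure lborel (cbox a (a + vec l)) = l ^ CARD('n)"
    using assms by (subst content_cbox_cart) (auto simp: interval_eq_empty_cart not_less)
  moreover have "measure lborel (cbox b (b + vec r)) = r ^ CARD('m)"
    using assms by (subst content_cbox_cart) (auto simp: interval_eq_empty_cart not_less)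
  ultimately show ?thesis by simp
qed

lemma cube_norm_le:
  fixes a :: "real^'n"
  assumes "x \<in> cbox a (a + vec l)"
  shows "norm (x - a) \<le> real CARD('n) * l"
proof -
  have "norm (x - a) \<le> (\<Sum>i\<in>UNIV. \<bar>(x - a) $ i\<bar>)" by (rule norm_le_l1_cart)
  also have "\<dots> \<le> (\<Sum>i\<in>(UNIV::'n set). l)"
  proof (intro sum_mono)
    fix i
    have "a $ i \<le> x $ i" "x $ i \<le> a $ i + l" using assms by (auto simp: mem_box_cart)
    then show "\<bar>(x - a) $ i\<bar> \<le> l" by simp
  qed
  finally show ?thesis by simp
qed

lemma rectanglesE:
  fixes R :: "((real^'n) \<times> (real^'m)) set"
  assumes "R \<in> rectangles"
  obtains a1 :: "real^'n" and a2 :: "real^'m" and l r where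
    "R = cbox a1 (a1 + vec l) \<times> cbox a2 (a2 + vec r)" "l > 0" "r > 0"
  using assms unfolding rectangles_def cubes_def by blast

lemma rectangleI:
  "l > 0 \<Longrightarrow> r > 0 \<Longrightarrow> cbox a1 (a1 + vec l) \<times> cbox a2 (a2 + vec r) \<in> rectangles"
  unfolding rectangles_def cubes_def by blast

lemma rectangle_props:
  assumes "R \<in> rectangles"
  shows "compact R" "R \<in> sets lebesgue" "R \<in> lmeasurable" "measure lebesgue R > 0"
    "emeasure lebesgue R = ennreal (measure lebesgue R)"
proof -
  obtain a1 a2 l r where R: "R = cbox a1 (a1 + vec l) \<times> cbox a2 (a2 + vec r)" "l > 0" "r > 0"
    using rectanglesE[OF assms] .
  show "compact R" unfolding R by (intro compact_Times) auto
  then show l: "R \<in> lmeasurable" by (rule lmeasurable_compact)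
  then show "R \<in> sets lebesgue" by blast
  show "measure lebesgue R > 0" unfolding R(1) using R by (subst measure_rectangle) auto
  show "emeasure lebesgue R = ennreal (measure lebesgue R)"
    using l by (rule emeasure_eq_measure2[rotated])
qed

text \<open>A cube has diameter at most its dimension times its side length, so two cubes of side length \<open>l\<close>
  whose corners are at distance above \<open>(2n + 1) l\<close> are at distance at least \<open>l\<close>.\<close>
lemma setdist_companion_cube:
  fixes a x :: "real^'n"
  assumes "A \<ge> 2 * real CARD('n) + 1" "l > 0" "A * l < norm (x - a)" "norm (x - a) \<le> B * l" "B \<ge> 1"
  shows "comparable B (setdist (cbox a (a + vec l)) (cbox x (x + vec l))) l"
    and "\<And>u v. u \<in> cbox x (x + vec l) \<Longrightarrow> v \<in> cbox a (a + vec l) \<Longrightarrow> u \<noteq> v"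
proof -
  have mem: "a \<in> cbox a (a + vec l)" "x \<in> cbox x (x + vec l)"
    using assms by (auto simp: mem_box_cart)
  have far: "l \<le> dist v u" if "u \<in> cbox x (x + vec l)" "v \<in> cbox a (a + vec l)" for u v
  proof -
    have "norm (x - a) \<le> norm (u - x) + norm (v - a) + dist v u"
      by norm
    moreover have "(2 * real CARD('n) + 1) * l \<le> A * l" using assms by (intro mult_right_mono) auto
    ultimately show ?thesis
      using cube_norm_le[OF that(1)] cube_norm_le[OF that(2)] assms(3) by (simp add: algebra_simps)
  qed
  have "setdist (cbox a (a + vec l)) (cbox x (x + vec l)) \<le> dist a x"
    using mem by (rule setdist_le_dist)
  also have "\<dots> \<le> B * l" using assms by (simp add: dist_norm norm_minus_commute)
  finally have 1: "setdist (cbox a (a + vec l)) (cbox x (x + vec l)) \<le> B * l" .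
  have "l \<le> setdist (cbox a (a + vec l)) (cbox x (x + vec l))"
    using mem far by (intro le_setdistI) auto
  moreover have "l / B \<le> l" using assms by (simp add: divide_le_eq)
  ultimately show "comparable B (setdist (cbox a (a + vec l)) (cbox x (x + vec l))) l"
    using 1 by (simp add: comparable_def)
  show "u \<noteq> v" if "u \<in> cbox x (x + vec l)" "v \<in> cbox a (a + vec l)" for u v
    using far[OF that] assms by auto
qed

text \<open>The common cube makes the two cubes accessible to a single application of the \<open>A\<^sub>p\<close> condition.\<close>
lemma cubes_subset_common_cube:
  fixes a x :: "real^'n"
  assumes "norm (x - a) \<le> B * l" "l > 0" "B \<ge> 0"
  shows "cbox a (a + vec l) \<subseteq> cbox (a - vec (B * l)) (a - vec (B * l) + vec ((2 * B + 1) * l))"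
    and "cbox x (x + vec l) \<subseteq> cbox (a - vec (B * l)) (a - vec (B * l) + vec ((2 * B + 1) * l))"
proof -
  have c: "\<bar>x $ i - a $ i\<bar> \<le> B * l" for i
    using component_le_norm_cart[of "x - a" i] assms(1) by simp
  have "B * l \<ge> 0" using assms by simp
  then show "cbox a (a + vec l) \<subseteq> cbox (a - vec (B * l)) (a - vec (B * l) + vec ((2 * B + 1) * l))"
    by (auto simp: mem_box_cart subset_eq algebra_simps) (smt (verit))+
  show "cbox x (x + vec l) \<subseteq> cbox (a - vec (B * l)) (a - vec (B * l) + vec ((2 * B + 1) * l))"
  proof
    fix u assume u: "u \<in> cbox x (x + vec l)"
    show "u \<in> cbox (a - vec (B * l)) (a - vec (B * l) + vec ((2 * B + 1) * l))"
      unfolding mem_box_cart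
    proof
      fix i
      have "x $ i \<le> u $ i" "u $ i \<le> x $ i + l" using u by (auto simp: mem_box_cart)
      moreover have "(2 * B + 1) * l = 2 * (B * l) + l" by (simp add: algebra_simps)
      ultimately show "(a - vec (B * l)) $ i \<le> u $ i \<and> u $ i \<le> (a - vec (B * l) + vec ((2 * B + 1) * l)) $ i"
        using c[of i] by (simp add: abs_le_iff)
    qed
  qed
qed

section \<open>Muckenhoupt weights\<close>

lemma set_nn_integral_pos:
  fixes f :: "'a::euclidean_space \<Rightarrow> real"
  assumes "f \<in> borel_measurable lebesgue" "AE x in lebesgue. f x > 0"
    "E \<in> sets lebesgue" "emeasure lebesgue E > 0"
  shows "(\<integral>\<^sup>+x\<in>E. ennreal (f x) \<partial>lebesgue) > 0"
proof (rule ccontr)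
  assume "\<not> ?thesis"
  then have "(\<integral>\<^sup>+x\<in>E. ennreal (f x) \<partial>lebesgue) = 0" by (simp add: not_gr_zero)
  then have "AE x in lebesgue. ennreal (f x) * indicator E x = 0"
    using assms by (subst (asm) nn_integral_0_iff_AE) auto
  with assms(2) have "AE x in lebesgue. x \<notin> E"
    by eventually_elim (auto split: split_indicator)
  then have "emeasure lebesgue E = 0"
    using assms by (subst (asm) AE_iff_measurable[where N = E]) auto
  then show False using assms by simp
qed

lemma L_loc_nn_integral_finite:
  assumes "L_loc k f" "compact S"
  shows "(\<integral>\<^sup>+x\<in>S. ennreal (\<bar>f x\<bar> ^ k) \<partial>lebesgue) < \<infinity>"
proof -
  have "integrable lebesgue (\<lambda>x. indicator S x *\<^sub>R \<bar>f x\<bar> ^ k)"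
    using assms unfolding L_loc_def set_integrable_def by blast
  then have "(\<integral>\<^sup>+x. ennreal (norm (indicator S x *\<^sub>R \<bar>f x\<bar> ^ k)) \<partial>lebesgue) < \<infinity>"
    unfolding integrable_iff_bounded by blast
  moreover have "(\<integral>\<^sup>+x. ennreal (norm (indicator S x *\<^sub>R \<bar>f x\<bar> ^ k)) \<partial>lebesgue)
      = (\<integral>\<^sup>+x\<in>S. ennreal (\<bar>f x\<bar> ^ k) \<partial>lebesgue)"
    by (intro nn_integral_cong) (auto split: split_indicator)
  ultimately show ?thesis by simp
qed

lemma weight_measure_finite_pos:
  assumes "weight w" "E \<subseteq> S" "compact S" "E \<in> sets lebesgue" "measure lebesgue E > 0"
  obtains W where "W > 0" "weight_measure w E = ennreal W"
proof -
  have w: "w \<in> borel_measurable lebesgue" "AE x in lebesgue. w x > 0"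
    using assms(1) by (auto simp: weight_def L_loc_def)
  have "weight_measure w E \<le> (\<integral>\<^sup>+x\<in>S. ennreal (\<bar>w x\<bar> ^ 1) \<partial>lebesgue)"
    unfolding weight_measure_def using assms(2)
    by (intro nn_integral_mono) (auto split: split_indicator intro: ennreal_leI)
  also have "\<dots> < \<infinity>" using assms by (intro L_loc_nn_integral_finite) (auto simp: weight_def)
  finally have fin: "weight_measure w E < \<infinity>" .
  have "emeasure lebesgue E \<noteq> 0" using assms(5) by (auto simp: measure_def)
  then have "emeasure lebesgue E > 0" by (simp add: zero_less_iff_neq_zero)
  then have "weight_measure w E > 0"
    unfolding weight_measure_def using w assms by (intro set_nn_integral_pos) auto
  with fin show ?thesis
    by (intro that[of "enn2real (weight_measure w E)"]) (auto simp: enn2real_positive_iff)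
qed

lemma ennpowr_ennreal: "x \<ge> 0 \<Longrightarrow> ennpowr (ennreal x) a = ennreal (x powr a)"
  by (simp add: ennpowr_def)

text \<open>The \<open>A\<^sub>p\<close> bound on one rectangle, freed from averages and extended reals. The dual weight is
  integrable because the average of \<open>w\<close> is positive and the product in the \<open>A\<^sub>p\<close> characteristic is
  finite.\<close>
lemma Ap_dual_weight:
  fixes w :: "(real^'n) \<times> (real^'m) \<Rightarrow> real"
  assumes w: "w \<in> Ap p" and p: "p > 1" and R: "R \<in> rectangles"
    and M: "Ap_char p w \<le> ennreal M" "M > 0"
  obtains W \<Sigma> where "W > 0" "\<Sigma> > 0" "weight_measure w R = ennreal W"
    "(\<integral>\<^sup>+x\<in>R. ennreal (w x powr (- 1 / (p - 1))) \<partial>lebesgue) = ennreal \<Sigma>"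
    "W * \<Sigma> powr (p - 1) \<le> M * measure lebesgue R powr p"
proof -
  note Rp = rectangle_props[OF R]
  have ww: "weight w" and fin: "Ap_char p w < \<infinity>" using w by (auto simp: Ap_def)
  have e: "1 - p / (p - 1) = - 1 / (p - 1)" using p by (simp add: field_simps)
  define m where "m = measure lebesgue R"
  have m: "m > 0" "emeasure lebesgue R = ennreal m" using Rp by (auto simp: m_def)
  obtain W where W: "W > 0" "weight_measure w R = ennreal W"
    using weight_measure_finite_pos[OF ww order_refl] Rp by blast
  define s where "s = (\<integral>\<^sup>+x\<in>R. ennreal (w x powr (- 1 / (p - 1))) \<partial>lebesgue)"
  have wm: "w \<in> borel_measurable lebesgue" "AE x in lebesgue. w x > 0"
    using ww by (auto simp: weight_def L_loc_def)
  have spos: "s > 0" unfolding s_def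
    using wm Rp m by (intro set_nn_integral_pos) auto
  have le: "ennreal (W / m) * ennpowr (s / ennreal m) (p - 1) \<le> ennreal M"
  proof -
    have "nn_average w R * ennpowr (nn_average (\<lambda>x. w x powr (1 - p / (p - 1))) R) (p - 1) \<le> Ap_char p w"
      unfolding Ap_char_def using R by (rule SUP_upper)
    also have "\<dots> \<le> ennreal M" by fact
    finally show ?thesis
      using W m unfolding nn_average_def weight_measure_def e s_def
      by (simp add: divide_ennreal)
  qed
  have "s \<noteq> \<infinity>"
  proof
    assume "s = \<infinity>"
    then have "ennreal (W / m) * ennpowr (s / ennreal m) (p - 1) = \<infinity>"
      using W m by (simp add: ennreal_top_divide ennpowr_def ennreal_mult_top)
    with le show False by (simp add: top_unique)
  qed
  then obtain \<Sigma> where S: "s = ennreal \<Sigma>" "\<Sigma> > 0" using spos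
    by (cases s) (auto simp: ennreal_less_zero_iff)
  have "ennreal (W / m * (\<Sigma> / m) powr (p - 1)) \<le> ennreal M"
    using le S W m by (simp add: divide_ennreal ennpowr_ennreal flip: ennreal_mult)
  then have "W / m * (\<Sigma> / m) powr (p - 1) \<le> M" using M by (simp add: ennreal_le_iff)
  moreover have "m powr p = m * m powr (p - 1)" using m by (simp add: powr_diff)
  ultimately have "W * \<Sigma> powr (p - 1) \<le> M * m powr p"
    using m by (simp add: powr_divide field_simps)
  with W S show ?thesis by (intro that[of W \<Sigma>]) (auto simp: m_def s_def)
qed

lemma powr_inverse_weight: "w > 0 \<Longrightarrow> p > 1 \<Longrightarrow> w powr (1 / p) * (w powr (- 1 / (p - 1))) powr ((p - 1) / p) = (1::real)"
  by (simp add: powr_powr flip: powr_add)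

text \<open>This combines the doubling and the \<open>A\<^sub>\<infinity>\<close> property: a subset \<open>E\<close> with a definite share of the Lebesgue
  measure of \<open>Q\<close> has a definite share of the \<open>w\<close>-measure, not only compared with \<open>Q\<close> but also with
  any other part \<open>R\<close> of \<open>Q\<close>. The reason is \<open>1 = w^(1/p) w^(-1/p)\<close> on \<open>E\<close> and Hoelder's inequality, in
  which the dual weight is integrated over all of \<open>Q\<close>.\<close>
lemma Ap_subset_bound:
  fixes w :: "(real^'n) \<times> (real^'m) \<Rightarrow> real"
  assumes w: "w \<in> Ap p" and p: "p > 1" and Q: "Q \<in> rectangles"
    and M: "Ap_char p w \<le> ennreal M" "M > 0"
    and E: "E \<in> sets lebesgue" "E \<subseteq> Q" "weight_measure w E = ennreal V" "V > 0"
    and R: "R \<subseteq> Q" "weight_measure w R = ennreal W" "W > 0"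
  shows "W * measure lebesgue E powr p \<le> M * measure lebesgue Q powr p * V"
proof -
  note Qp = rectangle_props[OF Q]
  have wm: "w \<in> borel_measurable lebesgue" "AE x in lebesgue. w x > 0"
    using w by (auto simp: Ap_def weight_def L_loc_def)
  obtain W' \<Sigma> where d: "W' > 0" "\<Sigma> > 0" "weight_measure w Q = ennreal W'"
    "(\<integral>\<^sup>+x\<in>Q. ennreal (w x powr (- 1 / (p - 1))) \<partial>lebesgue) = ennreal \<Sigma>"
    "W' * \<Sigma> powr (p - 1) \<le> M * measure lebesgue Q powr p"
    using Ap_dual_weight[OF w p Q M] .
  have "weight_measure w R \<le> weight_measure w Q"
    unfolding weight_measure_def using R by (intro nn_integral_mono) (auto split: split_indicator)
  then have WW: "W \<le> W'" using R d by (simp add: ennreal_le_iff)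
  \<comment> \<open>The weight is positive only almost everywhere, hence the maximum with 0.\<close>
  define f where "f x = max (w x) 0 * indicator E x" for x
  define g where "g x = w x powr (- 1 / (p - 1)) * indicator Q x" for x
  have "emeasure lebesgue E = (\<integral>\<^sup>+x. indicator E x \<partial>lebesgue)" using E by simp
  also have "\<dots> \<le> (\<integral>\<^sup>+x. ennreal (f x powr (1 / p) * g x powr ((p - 1) / p) * f x powr 0) \<partial>lebesgue)"
  proof (rule nn_integral_mono_AE)
    show "AE x in lebesgue. indicator E x \<le> ennreal (f x powr (1 / p) * g x powr ((p - 1) / p) * f x powr 0)"
      using wm(2)
    proof eventually_elim
      case (elim x)
      show ?case
        using elim E(2) p powr_inverse_weight[OF elim p]
        by (cases "x \<in> E") (auto simp: f_def g_def)
    qed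
  qed
  also have "\<dots> \<le> ennreal (V powr (1 / p) * \<Sigma> powr ((p - 1) / p) * V powr 0)"
  proof (rule nn_integral_Hoelder3)
    have "(\<integral>\<^sup>+x. ennreal (f x) \<partial>lebesgue) = weight_measure w E"
      unfolding weight_measure_def f_def by (intro nn_integral_cong) (auto split: split_indicator simp: max_def ennreal_neg)
    then show "(\<integral>\<^sup>+x. ennreal (f x) \<partial>lebesgue) \<le> ennreal V" "(\<integral>\<^sup>+x. ennreal (f x) \<partial>lebesgue) \<le> ennreal V"
      using E by auto
    have "(\<integral>\<^sup>+x. ennreal (g x) \<partial>lebesgue) = (\<integral>\<^sup>+x\<in>Q. ennreal (w x powr (- 1 / (p - 1))) \<partial>lebesgue)"
      unfolding g_def by (intro nn_integral_cong) (auto split: split_indicator)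
    then show "(\<integral>\<^sup>+x. ennreal (g x) \<partial>lebesgue) \<le> ennreal \<Sigma>" using d by simp
    show "f \<in> borel_measurable lebesgue" "f \<in> borel_measurable lebesgue" "g \<in> borel_measurable lebesgue"
      unfolding f_def g_def using wm E Qp by auto
    show "1 / p + (p - 1) / p + 0 = 1" using p by (simp add: field_simps)
  qed (use p E d in \<open>auto simp: f_def g_def\<close>)
  finally have "emeasure lebesgue E \<le> ennreal (V powr (1 / p) * \<Sigma> powr ((p - 1) / p))"
    using E by simp
  then have "measure lebesgue E \<le> V powr (1 / p) * \<Sigma> powr ((p - 1) / p)"
    unfolding measure_def by (intro enn2real_leI) auto
  then have "measure lebesgue E powr p \<le> (V powr (1 / p) * \<Sigma> powr ((p - 1) / p)) powr p"
    using p by (intro powr_mono2) auto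
  also have "\<dots> = V * \<Sigma> powr (p - 1)"
    using p E d by (simp add: powr_mult powr_powr)
  finally have "W * measure lebesgue E powr p \<le> W' * (V * \<Sigma> powr (p - 1))"
    using WW R E d by (intro mult_mono) auto
  also have "\<dots> \<le> M * measure lebesgue Q powr p * V"
    using mult_right_mono[OF d(5), of V] E by (simp add: algebra_simps)
  finally show ?thesis .
qed

text \<open>With \<open>s = k / (k + 1)\<close> and \<open>q = 1 / (p k)\<close>, the product of the powers \<open>s\<close>, \<open>s (p - 1) q\<close> and
  \<open>s q\<close> of \<open>\<nu>^(1/k)\<close>, \<open>\<mu>^(-1/(p-1))\<close> and \<open>\<lambda>\<close> is 1 almost everywhere, and the exponents add up to
  1. So Hoelder's inequality bounds \<open>|R|\<close> by the corresponding product of integrals, and the \<open>A\<^sub>p\<close> condition for \<open>\<mu>\<close> trades the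
  integral of the dual weight for a negative power of \<open>\<mu>(R)\<close>.\<close>
lemma Ap_bloom_ratio_bound:
  fixes \<mu> lam :: "(real^'n) \<times> (real^'m) \<Rightarrow> real" and k :: nat
  assumes \<mu>: "\<mu> \<in> Ap p" and lam: "weight lam" and p: "p > 1" and k: "k \<ge> 1" and R: "R \<in> rectangles"
    and M: "Ap_char p \<mu> \<le> ennreal M" "M > 0"
    and W: "weight_measure \<mu> R = ennreal W" "W > 0"
    and L: "weight_measure lam R = ennreal L" "L > 0"
    and V: "weight_measure (\<lambda>x. (\<mu> x powr (1 / p) * lam x powr (- 1 / p)) powr (1 / real k)) R = ennreal V" "V > 0"
  shows "(W / L) powr (1 / (p * real k)) * measure lebesgue R \<le> M powr (1 / (p * real k)) * V"
proof -
  note Rp = rectangle_props[OF R]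
  have wm: "\<mu> \<in> borel_measurable lebesgue" "AE x in lebesgue. \<mu> x > 0"
    "lam \<in> borel_measurable lebesgue" "AE x in lebesgue. lam x > 0"
    using \<mu> lam by (auto simp: Ap_def weight_def L_loc_def)
  obtain W' \<Sigma> where d: "W' > 0" "\<Sigma> > 0" "weight_measure \<mu> R = ennreal W'"
    "(\<integral>\<^sup>+x\<in>R. ennreal (\<mu> x powr (- 1 / (p - 1))) \<partial>lebesgue) = ennreal \<Sigma>"
    "W' * \<Sigma> powr (p - 1) \<le> M * measure lebesgue R powr p"
    using Ap_dual_weight[OF \<mu> p R M] .
  have "W' = W" using d W by simp
  note d5 = d(5)[unfolded this]
  define m where "m = measure lebesgue R"
  have m: "m > 0" "emeasure lebesgue R = ennreal m" using Rp by (auto simp: m_def)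
  define s where "s = real k / (real k + 1)"
  define q where "q = 1 / (p * real k)"
  have s: "s > 0" using k by (auto simp: s_def)
  have q: "q > 0" using k p by (auto simp: q_def)
  have pq: "p * q = 1 / real k" using p by (simp add: q_def)
  have "1 + 1 / real k = (real k + 1) / real k" using k by (simp add: field_simps)
  then have s1: "s * (1 + 1 / real k) = 1" using k by (simp add: s_def)
  define f where "f x = (\<mu> x powr (1 / p) * lam x powr (- 1 / p)) powr (1 / real k) * indicator R x" for x
  define g where "g x = \<mu> x powr (- 1 / (p - 1)) * indicator R x" for x
  define h where "h x = max (lam x) 0 * indicator R x" for x
  have pt: "((u powr (1 / p) * v powr (- 1 / p)) powr (1 / real k)) powr s * (u powr (- 1 / (p - 1))) powr (s * (p - 1) * q) * v powr (s * q) = 1"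
    if "u > 0" "v > 0" for u v :: real
  proof -
    have "(u powr (1 / p) * v powr (- 1 / p)) powr (1 / real k) = u powr q * v powr (- q)"
      using that by (simp add: powr_mult powr_powr q_def)
    then have "((u powr (1 / p) * v powr (- 1 / p)) powr (1 / real k)) powr s = u powr (s * q) * v powr (- (s * q))"
      using that by (simp add: powr_mult powr_powr mult.commute)
    moreover have "(u powr (- 1 / (p - 1))) powr (s * (p - 1) * q) = u powr (- (s * q))"
      using p by (simp add: powr_powr)
    ultimately have "?thesis \<longleftrightarrow> u powr (s * q) * v powr (- (s * q)) * u powr (- (s * q)) * v powr (s * q) = 1" by presburger
    then show ?thesis using that by (simp add: powr_minus field_simps)
  qed
  have "emeasure lebesgue R = (\<integral>\<^sup>+x. indicator R x \<partial>lebesgue)" using Rp by simp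
  also have "\<dots> \<le> (\<integral>\<^sup>+x. ennreal (f x powr s * g x powr (s * (p - 1) * q) * h x powr (s * q)) \<partial>lebesgue)"
  proof (rule nn_integral_mono_AE)
    show "AE x in lebesgue. indicator R x \<le> ennreal (f x powr s * g x powr (s * (p - 1) * q) * h x powr (s * q))"
      using wm(2) wm(4)
    proof eventually_elim
      case (elim x)
      show ?case
        using elim pt[OF elim]
        by (cases "x \<in> R") (auto simp: f_def g_def h_def)
    qed
  qed
  also have "\<dots> \<le> ennreal (V powr s * \<Sigma> powr (s * (p - 1) * q) * L powr (s * q))"
  proof (rule nn_integral_Hoelder3)
    have "(\<integral>\<^sup>+x. ennreal (f x) \<partial>lebesgue) = ennreal V"
      unfolding f_def V(1)[unfolded weight_measure_def, symmetric] by (intro nn_integral_cong) (auto split: split_indicator)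
    then show "(\<integral>\<^sup>+x. ennreal (f x) \<partial>lebesgue) \<le> ennreal V" by simp
    have "(\<integral>\<^sup>+x. ennreal (g x) \<partial>lebesgue) = ennreal \<Sigma>"
      unfolding g_def d(4)[symmetric] by (intro nn_integral_cong) (auto split: split_indicator)
    then show "(\<integral>\<^sup>+x. ennreal (g x) \<partial>lebesgue) \<le> ennreal \<Sigma>" by simp
    have "(\<integral>\<^sup>+x. ennreal (h x) \<partial>lebesgue) = ennreal L"
      unfolding h_def L(1)[unfolded weight_measure_def, symmetric] by (intro nn_integral_cong) (auto split: split_indicator simp: max_def ennreal_neg)
    then show "(\<integral>\<^sup>+x. ennreal (h x) \<partial>lebesgue) \<le> ennreal L" by simp
    show "f \<in> borel_measurable lebesgue" "g \<in> borel_measurable lebesgue" "h \<in> borel_measurable lebesgue"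
      unfolding f_def g_def h_def using wm Rp by auto
    have "s + s * (p - 1) * q + s * q = s * (1 + p * q)" by (simp add: algebra_simps)
    then show "s + s * (p - 1) * q + s * q = 1" using pq s1 by simp
  qed (use p s q d V L in \<open>auto simp: f_def g_def h_def\<close>)
  finally have "m \<le> V powr s * \<Sigma> powr (s * (p - 1) * q) * L powr (s * q)"
    using m by (simp add: ennreal_le_iff)
  then have "m powr (1 / s) \<le> (V powr s * \<Sigma> powr (s * (p - 1) * q) * L powr (s * q)) powr (1 / s)"
    using m s by (intro powr_mono2) auto
  also have "\<dots> = V * \<Sigma> powr ((p - 1) * q) * L powr q"
    using s V d L by (simp add: powr_mult powr_powr)
  finally have 1: "m powr (1 / s) \<le> V * \<Sigma> powr ((p - 1) * q) * L powr q" .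
  have "(W * \<Sigma> powr (p - 1)) powr q \<le> (M * m powr p) powr q"
    using d5 q W by (intro powr_mono2) (auto simp: m_def)
  then have 2: "W powr q * \<Sigma> powr ((p - 1) * q) \<le> M powr q * m powr (p * q)"
    using W M m by (simp add: powr_mult powr_powr)
  have s': "1 / s = 1 + p * q" using s1 s pq by (simp add: field_simps)
  have "W powr q * m * m powr (p * q) = W powr q * m powr (1 / s)"
    using m by (simp add: s' powr_add)
  also have "\<dots> \<le> W powr q * (V * \<Sigma> powr ((p - 1) * q) * L powr q)"
    using 1 by (intro mult_left_mono) auto
  also have "\<dots> = (W powr q * \<Sigma> powr ((p - 1) * q)) * (V * L powr q)" by simp
  also have "\<dots> \<le> (M powr q * m powr (p * q)) * (V * L powr q)"
    using 2 V by (intro mult_right_mono) auto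
  finally have "(W powr q * m) * m powr (p * q) \<le> (M powr q * V * L powr q) * m powr (p * q)"
    by (simp add: mult_ac)
  then have "W powr q * m \<le> M powr q * V * L powr q" using m by simp
  then have "(W / L) powr q * m \<le> M powr q * V"
    using L W by (simp add: powr_divide field_simps)
  then show ?thesis by (simp add: q_def m_def)
qed

section \<open>Bi-parameter kernels away from the diagonal\<close>

lemma size_bound_le:
  assumes "0 < a" "a \<le> u"
  shows "size_bound d u \<le> 1 / a ^ d"
  unfolding size_bound_def using assms by (intro divide_left_mono power_mono mult_pos_pos) auto

lemma size_bound_nonneg: "u \<ge> 0 \<Longrightarrow> size_bound d u \<ge> 0"
  by (simp add: size_bound_def)

lemma hoelder_bound_nonneg: "hoelder_bound d \<delta> h u \<ge> 0"
  by (simp add: hoelder_bound_def)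

text \<open>A perturbation that is a fraction \<open>\<theta>\<close> of the distance gains the factor \<open>\<theta>^\<delta>\<close> over the size bound.\<close>
lemma hoelder_bound_le:
  assumes "0 < a" "a \<le> u" "0 \<le> h" "h \<le> \<theta> * a" "\<theta> \<ge> 0" "\<delta> > 0"
  shows "hoelder_bound d \<delta> h u \<le> \<theta> powr \<delta> / a ^ d"
proof -
  have "hoelder_bound d \<delta> h u \<le> (\<theta> * a) powr \<delta> / a powr (real d + \<delta>)"
    unfolding hoelder_bound_def using assms by (intro frac_le powr_mono2) auto
  also have "\<dots> = \<theta> powr \<delta> / a ^ d"
    using assms by (simp add: powr_mult powr_add powr_realpow)
  finally show ?thesis .
qed

text \<open>The four mixed estimates in a uniform shape: varying any single variable by a fraction \<open>\<theta>\<close> of the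
  distance costs at most \<open>\<theta>^\<delta>\<close> times the size bound.\<close>
lemma kernel_mixed_step:
  fixes K :: "(real^'n) \<times> (real^'m) \<Rightarrow> (real^'n) \<times> (real^'m) \<Rightarrow> complex"
  assumes K: "kernel_mixed \<delta> CK K" and "CK \<ge> 0" "\<delta> > 0"
    and ab: "a > 0" "b > 0" "a \<le> norm (x1 - y1)" "b \<le> norm (x2 - y2)"
    and \<theta>: "\<theta> \<ge> 0" "\<theta> \<le> 1 / 2"
  defines "B \<equiv> CK * \<theta> powr \<delta> / (a ^ CARD('n) * b ^ CARD('m))"
  shows "norm (y1 - y1') \<le> \<theta> * a \<Longrightarrow> norm (K (x1, x2) (y1, y2) - K (x1, x2) (y1', y2)) \<le> B" (is "_ \<Longrightarrow> ?G1")
    and "norm (x1 - x1') \<le> \<theta> * a \<Longrightarrow> norm (K (x1, x2) (y1, y2) - K (x1', x2) (y1, y2)) \<le> B" (is "_ \<Longrightarrow> ?G2")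
    and "norm (y2 - y2') \<le> \<theta> * b \<Longrightarrow> norm (K (x1, x2) (y1, y2) - K (x1, x2) (y1, y2')) \<le> B" (is "_ \<Longrightarrow> ?G3")
    and "norm (x2 - x2') \<le> \<theta> * b \<Longrightarrow> norm (K (x1, x2) (y1, y2) - K (x1, x2') (y1, y2)) \<le> B" (is "_ \<Longrightarrow> ?G4")
proof -
  have ne: "x1 \<noteq> y1" "x2 \<noteq> y2" using ab by auto
  have half: "h \<le> norm (x1 - y1) / 2" if "h \<le> \<theta> * a" for h
  proof -
    have "\<theta> * a \<le> 1 / 2 * norm (x1 - y1)" using \<theta> ab by (intro mult_mono) auto
    then show ?thesis using that by simp
  qed
  have half': "h \<le> norm (x2 - y2) / 2" if "h \<le> \<theta> * b" for h
  proof -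
    have "\<theta> * b \<le> 1 / 2 * norm (x2 - y2)" using \<theta> ab by (intro mult_mono) auto
    then show ?thesis using that by simp
  qed
  note km0 = K[unfolded kernel_mixed_def, rule_format, OF ne]
  note km = km0[THEN conjunct1, rule_format] km0[THEN conjunct2, THEN conjunct1, rule_format]
    km0[THEN conjunct2, THEN conjunct2, THEN conjunct1, rule_format]
    km0[THEN conjunct2, THEN conjunct2, THEN conjunct2, rule_format]
  have B1: "CK * hoelder_bound CARD('n) \<delta> h (norm (x1 - y1)) * size_bound CARD('m) (norm (x2 - y2)) \<le> B"
    if "0 \<le> h" "h \<le> \<theta> * a" for h
  proof -
    have "CK * hoelder_bound CARD('n) \<delta> h (norm (x1 - y1)) * size_bound CARD('m) (norm (x2 - y2))
        \<le> CK * (\<theta> powr \<delta> / a ^ CARD('n)) * (1 / b ^ CARD('m))"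
      using assms that
      by (intro mult_mono hoelder_bound_le size_bound_le mult_nonneg_nonneg hoelder_bound_nonneg size_bound_nonneg) auto
    then show ?thesis by (simp add: B_def)
  qed
  have B2: "CK * size_bound CARD('n) (norm (x1 - y1)) * hoelder_bound CARD('m) \<delta> h (norm (x2 - y2)) \<le> B"
    if "0 \<le> h" "h \<le> \<theta> * b" for h
  proof -
    have "CK * size_bound CARD('n) (norm (x1 - y1)) * hoelder_bound CARD('m) \<delta> h (norm (x2 - y2))
        \<le> CK * (1 / a ^ CARD('n)) * (\<theta> powr \<delta> / b ^ CARD('m))"
      using assms that
      by (intro mult_mono hoelder_bound_le size_bound_le mult_nonneg_nonneg hoelder_bound_nonneg size_bound_nonneg) auto
    then show ?thesis by (simp add: B_def)
  qed
  show ?G1 if "norm (y1 - y1') \<le> \<theta> * a"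
    using order_trans[OF km(1)[OF half[OF that]] B1[OF norm_ge_zero that]] .
  show ?G2 if "norm (x1 - x1') \<le> \<theta> * a"
    using order_trans[OF km(2)[OF half[OF that]] B1[OF norm_ge_zero that]] .
  show ?G3 if "norm (y2 - y2') \<le> \<theta> * b"
    using order_trans[OF km(3)[OF half'[OF that]] B2[OF norm_ge_zero that]] .
  show ?G4 if "norm (x2 - x2') \<le> \<theta> * b"
    using order_trans[OF km(4)[OF half'[OF that]] B2[OF norm_ge_zero that]] .
qed

text \<open>Move the four variables one after another; the factor 2 in the distances at the starting point
  leaves room for the distances at the intermediate points to shrink.\<close>
lemma kernel_mixed_near_constant:
  fixes K :: "(real^'n) \<times> (real^'m) \<Rightarrow> (real^'n) \<times> (real^'m) \<Rightarrow> complex"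
  assumes K: "kernel_mixed \<delta> CK K" "CK \<ge> 0" "\<delta> > 0"
    and ab: "a > 0" "b > 0" "2 * a \<le> norm (x1 - y1)" "2 * b \<le> norm (x2 - y2)"
    and \<theta>: "\<theta> \<ge> 0" "\<theta> \<le> 1 / 2"
    and le: "norm (x1 - u1) \<le> \<theta> * a" "norm (x2 - u2) \<le> \<theta> * b"
      "norm (y1 - v1) \<le> \<theta> * a" "norm (y2 - v2) \<le> \<theta> * b"
  shows "norm (K (u1, u2) (v1, v2) - K (x1, x2) (y1, y2))
    \<le> 4 * (CK * \<theta> powr \<delta> / (a ^ CARD('n) * b ^ CARD('m)))"
proof -
  have \<theta>a: "\<theta> * a \<le> a / 2" "\<theta> * b \<le> b / 2" using \<theta> ab mult_right_mono[of \<theta> "1/2"] by auto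
  have tri: "norm (x1 - y1) \<le> norm (x1 - u1) + norm (u1 - y1)" "norm (x2 - y2) \<le> norm (x2 - u2) + norm (u2 - y2)"
    "norm (u1 - y1) \<le> norm (u1 - v1) + norm (y1 - v1)"
    using norm_triangle_ineq[of "x1 - u1" "u1 - y1"] norm_triangle_ineq[of "x2 - u2" "u2 - y2"]
      norm_triangle_ineq4[of "u1 - v1" "y1 - v1"] by simp_all
  have 1: "a \<le> norm (u1 - y1)" and 2: "b \<le> norm (u2 - y2)" and 3: "a \<le> norm (u1 - v1)"
    using tri ab le \<theta>a by linarith+
  note st = kernel_mixed_step[OF K ab(1,2)]
  have "norm (K (x1, x2) (y1, y2) - K (u1, x2) (y1, y2)) \<le> (CK * \<theta> powr \<delta> / (a ^ CARD('n) * b ^ CARD('m)))"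
    using ab \<theta> le by (intro st(2)) auto
  moreover have "norm (K (u1, x2) (y1, y2) - K (u1, u2) (y1, y2)) \<le> (CK * \<theta> powr \<delta> / (a ^ CARD('n) * b ^ CARD('m)))"
    using ab \<theta> le 1 by (intro st(4)) auto
  moreover have "norm (K (u1, u2) (y1, y2) - K (u1, u2) (v1, y2)) \<le> (CK * \<theta> powr \<delta> / (a ^ CARD('n) * b ^ CARD('m)))"
    using ab \<theta> le 1 2 by (intro st(1)) auto
  moreover have "norm (K (u1, u2) (v1, y2) - K (u1, u2) (v1, v2)) \<le> (CK * \<theta> powr \<delta> / (a ^ CARD('n) * b ^ CARD('m)))"
    using ab \<theta> le 2 3 by (intro st(3)) auto
  moreover have "K (u1, u2) (v1, v2) - K (x1, x2) (y1, y2)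
      = - (((K (x1, x2) (y1, y2) - K (u1, x2) (y1, y2)) + (K (u1, x2) (y1, y2) - K (u1, u2) (y1, y2)))
        + ((K (u1, u2) (y1, y2) - K (u1, u2) (v1, y2)) + (K (u1, u2) (v1, y2) - K (u1, u2) (v1, v2))))"
    by simp
  ultimately show ?thesis
    unfolding norm_minus_cancel by (smt (verit) norm_minus_cancel norm_triangle_ineq)
qed

lemma ex_large_ratio:
  fixes S \<delta> Q :: real
  assumes "S > 0" "\<delta> > 0" "Q > 0"
  shows "\<exists>A\<ge>4 * S. (2 * S / A) powr \<delta> * Q \<le> 1"
proof -
  \<comment> \<open>The first summand ensures \<open>A \<ge> 4 S\<close>, the second one solves \<open>(2 S / A)^\<delta> = 1 / Q\<close>.\<close>
  define A where "A = 4 * S + 2 * S * Q powr (1 / \<delta>)"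
  have q: "Q powr (1 / \<delta>) > 0" using assms by simp
  have A: "A > 0" "A \<ge> 4 * S" "A \<ge> 2 * S * Q powr (1 / \<delta>)" unfolding A_def using assms q
    by (auto intro!: add_pos_pos)
  have "2 * S / A \<le> 1 / Q powr (1 / \<delta>)"
    using A q by (simp add: field_simps)
  then have "(2 * S / A) powr \<delta> \<le> (1 / Q powr (1 / \<delta>)) powr \<delta>"
    using A assms by (intro powr_mono2) auto
  also have "\<dots> = 1 / Q" using assms by (simp add: powr_divide powr_powr)
  finally show ?thesis using A assms by (auto simp: field_simps)
qed

text \<open>The size bound at a single pair of points already forces the sign.\<close>
lemma full_kernel_constant_nonneg:
  fixes K :: "(real^'n) \<times> (real^'m) \<Rightarrow> (real^'n) \<times> (real^'m) \<Rightarrow> complex"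
  assumes "full_kernel \<delta> CK K"
  shows "CK \<ge> 0"
proof -
  have "(vec 1 :: real^'n) \<noteq> 0" "(vec 1 :: real^'m) \<noteq> 0" by (auto simp: vec_eq_iff)
  moreover have "kernel_size CK K" using assms by (simp add: full_kernel_def)
  ultimately have "norm (K (vec 1, vec 1) (0, 0)) \<le> CK * size_bound CARD('n) (norm (vec 1 - 0 :: real^'n))
      * size_bound CARD('m) (norm (vec 1 - 0 :: real^'m))"
    unfolding kernel_size_def by blast
  then have "0 \<le> CK * size_bound CARD('n) (norm (vec 1 :: real^'n)) * size_bound CARD('m) (norm (vec 1 :: real^'m))"
    using norm_ge_zero order_trans unfolding diff_zero by blast
  moreover have "size_bound CARD('n) (norm (vec 1 :: real^'n)) > 0" "size_bound CARD('m) (norm (vec 1 :: real^'m)) > 0"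
    using \<open>(vec 1 :: real^'n) \<noteq> 0\<close> \<open>(vec 1 :: real^'m) \<noteq> 0\<close> by (auto simp: size_bound_def)
  ultimately show ?thesis by (simp add: zero_le_mult_iff)
qed

text \<open>Non-degeneracy gives the lower bounds on the distances. For the upper bounds, compare the size
  estimate with the lower bound for the kernel: the product of the two distances is controlled, and
  since each of them is bounded below, each of them is bounded above. On rectangles with corners at
  the two points the kernel then varies by at most half its value at the corners, because the side
  lengths are a small fraction of the distances.\<close>
lemma nondegenerate_companion:
  fixes K :: "(real^'n) \<times> (real^'m) \<Rightarrow> (real^'n) \<times> (real^'m) \<Rightarrow> complex"
  defines "S \<equiv> real (CARD('n) + CARD('m))"
  assumes K: "full_kernel \<delta> CK K" "uniformly_nondegenerate cK K"
    and D: "D \<ge> 1" "CK \<le> D * cK"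
    and A: "A \<ge> 4 * S" "(2 * S / A) powr \<delta> * (8 * D * 2 ^ (CARD('n) + CARD('m))) \<le> 1"
    and lr: "l > 0" "r > 0"
  obtains x1 x2 where "A * l < norm (x1 - a1)" "norm (x1 - a1) \<le> D * A * l"
    "A * r < norm (x2 - a2)" "norm (x2 - a2) \<le> D * A * r"
    "cK / ((A * l) ^ CARD('n) * (A * r) ^ CARD('m)) \<le> norm (K (x1, x2) (a1, a2))"
    "\<And>u v. u \<in> cbox x1 (x1 + vec l) \<times> cbox x2 (x2 + vec r) \<Longrightarrow>
       v \<in> cbox a1 (a1 + vec l) \<times> cbox a2 (a2 + vec r) \<Longrightarrow>
       norm (K u v - K (x1, x2) (a1, a2)) \<le> norm (K (x1, x2) (a1, a2)) / 2"
proof -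
  have S: "S \<ge> 2" "real CARD('n) \<le> S" "real CARD('m) \<le> S"
    unfolding S_def using zero_less_card_finite[where 'a='n] zero_less_card_finite[where 'a='m] by linarith+
  then have Apos: "A > 0" using A by simp
  have cK: "cK > 0" using K(2) by (simp add: uniformly_nondegenerate_def)
  have CK: "CK \<ge> 0" using full_kernel_constant_nonneg[OF K(1)] .
  have \<delta>: "\<delta> > 0" and km: "kernel_mixed \<delta> CK K" and ks: "kernel_size CK K"
    using K(1) by (auto simp: full_kernel_def)
  have Al: "A * l > 0" "A * r > 0" using Apos lr by auto
  obtain x1 x2 where x: "norm (x1 - a1) > A * l" "norm (x2 - a2) > A * r"
    and big: "norm (K (x1, x2) (a1, a2)) \<ge> cK * size_bound CARD('n) (A * l) * size_bound CARD('m) (A * r)"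
    using K(2) Al unfolding uniformly_nondegenerate_def by blast
  have big': "cK / ((A * l) ^ CARD('n) * (A * r) ^ CARD('m)) \<le> norm (K (x1, x2) (a1, a2))"
    using big by (simp add: size_bound_def)
  have ne: "x1 \<noteq> a1" "x2 \<noteq> a2" using x Al by auto
  define u1 u2 where "u1 = norm (x1 - a1)" and "u2 = norm (x2 - a2)"
  have u: "u1 > 0" "u2 > 0" "u1 > A * l" "u2 > A * r" using ne x by (auto simp: u1_def u2_def)
  have "norm (K (x1, x2) (a1, a2)) \<le> CK * size_bound CARD('n) u1 * size_bound CARD('m) u2"
    using ks ne unfolding kernel_size_def u1_def u2_def by blast
  with big' have up: "cK / ((A * l) ^ CARD('n) * (A * r) ^ CARD('m)) \<le> CK / (u1 ^ CARD('n) * u2 ^ CARD('m))"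
    by (simp add: size_bound_def)
  have "CK / (u1 ^ CARD('n) * u2 ^ CARD('m)) \<le> D * cK / (u1 ^ CARD('n) * u2 ^ CARD('m))"
    using D u by (intro divide_right_mono) auto
  with up have "cK / ((A * l) ^ CARD('n) * (A * r) ^ CARD('m)) \<le> D * cK / (u1 ^ CARD('n) * u2 ^ CARD('m))" by simp
  then have prod: "u1 ^ CARD('n) * u2 ^ CARD('m) \<le> D * ((A * l) ^ CARD('n) * (A * r) ^ CARD('m))"
  proof -
    have "Q \<le> D * P" if "cK / P \<le> D * cK / Q" "P > 0" "Q > 0" for P Q
    proof -
      have "cK * Q \<le> cK * (D * P)" using that by (simp add: field_simps)
      then show ?thesis using cK by simp
    qed
    then show ?thesis using \<open>cK / _ \<le> D * cK / _\<close> u Al by simp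
  qed
  have root: "s \<le> D * t" if "s ^ d \<le> D * t ^ d" "d > 0" "s > 0" "t > 0" for s t :: real and d :: nat
  proof -
    have "D * t ^ d \<le> D ^ d * t ^ d"
      using D that self_le_power[of D d] by (intro mult_right_mono) auto
    with that(1) have "s ^ d \<le> (D * t) ^ d" unfolding power_mult_distrib by linarith
    then show ?thesis using that D power_mono_iff[of s "D * t" d] by simp
  qed
  have "u1 ^ CARD('n) * (A * r) ^ CARD('m) \<le> u1 ^ CARD('n) * u2 ^ CARD('m)"
    using u Al by (intro mult_left_mono power_mono) auto
  with prod have "u1 ^ CARD('n) * (A * r) ^ CARD('m) \<le> (D * (A * l) ^ CARD('n)) * (A * r) ^ CARD('m)"
    by (simp add: mult.assoc)
  then have "u1 ^ CARD('n) \<le> D * (A * l) ^ CARD('n)"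
    using Al by (simp add: zero_less_power)
  then have r1: "u1 \<le> D * (A * l)" by (rule root) (use u Al in auto)
  have "(A * l) ^ CARD('n) * u2 ^ CARD('m) \<le> u1 ^ CARD('n) * u2 ^ CARD('m)"
    using u Al by (intro mult_right_mono power_mono) auto
  with prod have "(A * l) ^ CARD('n) * u2 ^ CARD('m) \<le> (A * l) ^ CARD('n) * (D * (A * r) ^ CARD('m))"
    by (simp add: algebra_simps)
  then have "u2 ^ CARD('m) \<le> D * (A * r) ^ CARD('m)"
    using Al by (simp add: zero_less_power)
  then have r2: "u2 \<le> D * (A * r)" by (rule root) (use u Al in auto)
  \<comment> \<open>Half of the guaranteed distance \<open>A l\<close>, times \<open>\<theta>\<close>, is the bound \<open>S l\<close> for the diameter of a cube.\<close>
  define \<theta> where "\<theta> = 2 * S / A"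
  have \<theta>: "\<theta> \<ge> 0" "\<theta> \<le> 1 / 2" "\<theta> * (A * l / 2) = S * l" "\<theta> * (A * r / 2) = S * r"
    using S A Apos by (auto simp: \<theta>_def field_simps)
  have near: "norm (K u v - K (x1, x2) (a1, a2)) \<le> norm (K (x1, x2) (a1, a2)) / 2"
    if "u \<in> cbox x1 (x1 + vec l) \<times> cbox x2 (x2 + vec r)"
      and "v \<in> cbox a1 (a1 + vec l) \<times> cbox a2 (a2 + vec r)" for u v
  proof -
    obtain u1 u2 v1 v2 where uv: "u = (u1, u2)" "v = (v1, v2)" by (metis surj_pair)
    have c1: "norm (z - w) \<le> \<theta> * (A * l / 2)" if "w \<in> cbox z (z + vec l)" for w z :: "real^'n"
      unfolding \<theta>(3) norm_minus_commute[of z w]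
      using cube_norm_le[OF that] lr mult_right_mono[OF S(2), of l] by linarith
    have c2: "norm (z - w) \<le> \<theta> * (A * r / 2)" if "w \<in> cbox z (z + vec r)" for w z :: "real^'m"
      unfolding \<theta>(4) norm_minus_commute[of z w]
      using cube_norm_le[OF that] lr mult_right_mono[OF S(3), of r] by linarith
    have "norm (K u v - K (x1, x2) (a1, a2))
        \<le> 4 * (CK * \<theta> powr \<delta> / ((A * l / 2) ^ CARD('n) * (A * r / 2) ^ CARD('m)))"
      unfolding uv using that[unfolded uv] x Al \<theta>(1,2) CK \<delta>
      by (intro kernel_mixed_near_constant[OF km] c1 c2) auto
    also have "\<dots> = (4 * CK * \<theta> powr \<delta> * 2 ^ (CARD('n) + CARD('m))) / ((A * l) ^ CARD('n) * (A * r) ^ CARD('m))"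
      by (simp add: power_divide power_add)
    also have "\<dots> \<le> (cK / 2) / ((A * l) ^ CARD('n) * (A * r) ^ CARD('m))"
    proof (intro divide_right_mono)
      have "4 * CK * \<theta> powr \<delta> * 2 ^ (CARD('n) + CARD('m)) \<le> 4 * (D * cK) * \<theta> powr \<delta> * 2 ^ (CARD('n) + CARD('m))"
        using D by (intro mult_right_mono mult_left_mono) auto
      also have "\<dots> = (cK / 2) * (\<theta> powr \<delta> * (8 * D * 2 ^ (CARD('n) + CARD('m))))" by simp
      also have "\<dots> \<le> (cK / 2) * 1" using A(2) cK unfolding \<theta>_def by (intro mult_left_mono) auto
      finally show "4 * CK * \<theta> powr \<delta> * 2 ^ (CARD('n) + CARD('m)) \<le> cK / 2" by simp
    qed (use Al in auto)
    also have "\<dots> \<le> norm (K (x1, x2) (a1, a2)) / 2" using big' by simp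
    finally show ?thesis .
  qed
  show ?thesis
    using that[of x1 x2] x r1 r2 big' near by (simp add: u1_def u2_def mult.assoc)
qed

text \<open>The mixed Hoelder estimates yield joint continuity in the second argument, and with it the
  measurability of the integrand in the commutator.\<close>
lemma full_kernel_isCont:
  fixes K :: "(real^'n) \<times> (real^'m) \<Rightarrow> (real^'n) \<times> (real^'m) \<Rightarrow> complex"
  assumes K: "full_kernel \<delta> CK K" and ne: "u1 \<noteq> v1" "u2 \<noteq> v2"
  shows "isCont (K (u1, u2)) (v1, v2)"
proof -
  have CK: "CK \<ge> 0" using full_kernel_constant_nonneg[OF K] .
  have \<delta>: "\<delta> > 0" and km: "kernel_mixed \<delta> CK K" 
    using K by (auto simp: full_kernel_def)
  define a b where "a = norm (u1 - v1) / 2" and "b = norm (u2 - v2) / 2"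
  have ab: "a > 0" "b > 0" using ne by (auto simp: a_def b_def)
  define t where "t y = max (norm (fst y - v1) / a) (norm (snd y - v2) / b)" for y
  have t0: "(t \<longlongrightarrow> 0) (at (v1, v2))"
  proof -
    have "isCont t (v1, v2)" unfolding t_def using ab by (intro continuous_intros) auto
    then show ?thesis by (simp add: isCont_def t_def)
  qed
  have ev: "\<forall>\<^sub>F y in at (v1, v2). t y < 1 / 2"
    using order_tendstoD(2)[OF t0, of "1/2"] by simp
  define B where "B y = 4 * (CK * (t y) powr \<delta> / (a ^ CARD('n) * b ^ CARD('m)))" for y
  have "\<forall>\<^sub>F y in at (v1, v2). norm (K (u1, u2) y - K (u1, u2) (v1, v2)) \<le> B y"
    using ev
  proof eventually_elim
    case (elim y)
    have "norm (fst y - v1) / a \<le> t y" "norm (snd y - v2) / b \<le> t y" by (auto simp: t_def)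
    then have le: "norm (fst y - v1) \<le> t y * a" "norm (snd y - v2) \<le> t y * b"
      using ab by (auto simp: field_simps)
    have "t y \<ge> 0" using ab by (auto simp: t_def le_max_iff_disj)
    then have "norm (K (u1, u2) (fst y, snd y) - K (u1, u2) (v1, v2)) \<le> B y"
      unfolding B_def using le elim ab \<delta> CK
      by (intro kernel_mixed_near_constant[OF km]) (auto simp: a_def b_def norm_minus_commute)
    then show ?case by simp
  qed
  moreover have "(B \<longlongrightarrow> 0) (at (v1, v2))"
  proof -
    have "((\<lambda>y. t y powr \<delta>) \<longlongrightarrow> 0) (at (v1, v2))"
      by (rule tendsto_zero_powrI[OF t0 tendsto_const[of \<delta>]]) (use \<delta> ab in \<open>auto simp: t_def le_max_iff_disj\<close>)
    then have "((\<lambda>y. 4 * (CK * (t y) powr \<delta> / (a ^ CARD('n) * b ^ CARD('m)))) \<longlongrightarrow> 4 * (CK * 0 / (a ^ CARD('n) * b ^ CARD('m)))) (at (v1, v2))"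
      using ab by (intro tendsto_intros) auto
    then show ?thesis unfolding B_def by simp
  qed
  ultimately have "((\<lambda>y. K (u1, u2) y - K (u1, u2) (v1, v2)) \<longlongrightarrow> 0) (at (v1, v2))"
    by (rule Lim_null_comparison)
  then show ?thesis unfolding isCont_def by (simp add: LIM_zero_iff)
qed

section \<open>Lower bounds for the commutator\<close>

text \<open>If a complex kernel stays in the ball of radius \<open>|\<kappa>| / 2\<close> around \<open>\<kappa>\<close>, integrating it against a
  nonnegative function produces no cancellation.\<close>
lemma norm_integral_near_constant_ge:
  fixes \<psi> :: "'a \<Rightarrow> real" and \<kappa> :: "'a \<Rightarrow> complex"
  assumes \<psi>: "integrable M \<psi>" "\<And>y. \<psi> y \<ge> 0" and \<kappa>: "\<kappa> \<in> borel_measurable M"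
    and near: "\<And>y. \<psi> y \<noteq> 0 \<Longrightarrow> norm (\<kappa> y - \<kappa>0) \<le> norm \<kappa>0 / 2"
  shows "norm \<kappa>0 / 2 * (LINT y|M. \<psi> y) \<le> norm (LINT y|M. complex_of_real (\<psi> y) * \<kappa> y)"
proof -
  have [measurable]: "\<psi> \<in> borel_measurable M" using \<psi> by auto
  note \<kappa>[measurable]
  have le: "norm (complex_of_real (\<psi> y) * (\<kappa> y - \<kappa>0)) \<le> norm \<kappa>0 / 2 * \<psi> y" for y
  proof (cases "\<psi> y = 0")
    case False
    then show ?thesis using near[OF False] \<psi>(2)[of y] mult_left_mono[of _ _ "\<psi> y"]
      by (simp add: norm_mult mult.commute)
  qed simp
  have i: "integrable M (\<lambda>y. norm \<kappa>0 / 2 * \<psi> y)" using \<psi> by simp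
  have int: "integrable M (\<lambda>y. complex_of_real (\<psi> y) * (\<kappa> y - \<kappa>0))"
    by (rule Bochner_Integration.integrable_bound[OF i])
      (use order_trans[OF le abs_ge_self] in auto)
  have "norm (LINT y|M. complex_of_real (\<psi> y) * (\<kappa> y - \<kappa>0)) \<le> (LINT y|M. norm \<kappa>0 / 2 * \<psi> y)"
    using le by (intro order_trans[OF integral_norm_bound] integral_mono integrable_norm int i) auto
  also have "\<dots> = norm \<kappa>0 / 2 * (LINT y|M. \<psi> y)" by simp
  finally have 1: "norm (LINT y|M. complex_of_real (\<psi> y) * (\<kappa> y - \<kappa>0)) \<le> norm \<kappa>0 / 2 * (LINT y|M. \<psi> y)" .
  have int2: "integrable M (\<lambda>y. complex_of_real (\<psi> y) * \<kappa>0)" using \<psi> by simp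
  have "(LINT y|M. complex_of_real (\<psi> y) * \<kappa> y)
     = (LINT y|M. complex_of_real (\<psi> y) * (\<kappa> y - \<kappa>0) + complex_of_real (\<psi> y) * \<kappa>0)"
    by (simp add: algebra_simps)
  also have "\<dots> = (LINT y|M. complex_of_real (\<psi> y) * (\<kappa> y - \<kappa>0)) + complex_of_real (LINT y|M. \<psi> y) * \<kappa>0"
    using int int2 by (subst Bochner_Integration.integral_add) auto
  finally have eq: "(LINT y|M. complex_of_real (\<psi> y) * \<kappa> y)
    = (LINT y|M. complex_of_real (\<psi> y) * (\<kappa> y - \<kappa>0)) + complex_of_real (LINT y|M. \<psi> y) * \<kappa>0" .
  have nn: "(LINT y|M. \<psi> y) \<ge> 0" using \<psi> by (intro integral_nonneg_AE) auto
  have "norm (complex_of_real (LINT y|M. \<psi> y) * \<kappa>0) = norm \<kappa>0 * (LINT y|M. \<psi> y)"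
    using nn by (simp add: norm_mult)
  moreover have "norm (complex_of_real (LINT y|M. \<psi> y) * \<kappa>0) \<le>
     norm (LINT y|M. complex_of_real (\<psi> y) * \<kappa> y) + norm (LINT y|M. complex_of_real (\<psi> y) * (\<kappa> y - \<kappa>0))"
    unfolding eq using norm_triangle_ineq4[of "(LINT y|M. complex_of_real (\<psi> y) * (\<kappa> y - \<kappa>0))
        + complex_of_real (LINT y|M. \<psi> y) * \<kappa>0" "LINT y|M. complex_of_real (\<psi> y) * (\<kappa> y - \<kappa>0)"]
    unfolding add_diff_cancel_left' .
  ultimately show ?thesis using 1 by linarith
qed

lemma L_loc_integrable_power_diff:
  fixes b :: "'a::euclidean_space \<Rightarrow> real"
  assumes "L_loc k b" "compact S"
  shows "integrable lebesgue (\<lambda>y. indicator S y * \<bar>c - b y\<bar> ^ k)"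
proof -
  have b[measurable]: "b \<in> borel_measurable lebesgue" using assms by (simp add: L_loc_def)
  have S: "S \<in> lmeasurable" using assms by (intro lmeasurable_compact)
  then have [measurable]: "S \<in> sets lebesgue" by blast
  have "integrable lebesgue (\<lambda>x. indicator S x *\<^sub>R \<bar>b x\<bar> ^ k)"
    using assms unfolding L_loc_def set_integrable_def by blast
  moreover have "integrable lebesgue (indicator S :: 'a \<Rightarrow> real)"
    using S by (auto simp: integrable_indicator_iff fmeasurable_def)
  ultimately have i: "integrable lebesgue (\<lambda>y. 2 ^ k * \<bar>c\<bar> ^ k * indicator S y + 2 ^ k * (indicator S y *\<^sub>R \<bar>b y\<bar> ^ k))"
    by (intro Bochner_Integration.integrable_add integrable_mult_right)
  show ?thesis
  proof (rule Bochner_Integration.integrable_bound[OF i])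
    show "AE y in lebesgue. norm (indicator S y * \<bar>c - b y\<bar> ^ k)
      \<le> norm (2 ^ k * \<bar>c\<bar> ^ k * indicator S y + 2 ^ k * (indicator S y *\<^sub>R \<bar>b y\<bar> ^ k))"
    proof (rule AE_I2)
      fix y
      have "\<bar>c - b y\<bar> ^ k \<le> (2 * max \<bar>c\<bar> \<bar>b y\<bar>) ^ k" by (intro power_mono) auto
      also have "\<dots> \<le> 2 ^ k * (\<bar>c\<bar> ^ k + \<bar>b y\<bar> ^ k)"
        unfolding power_mult_distrib by (intro mult_left_mono) (auto simp: max_def)
      finally show "norm (indicator S y * \<bar>c - b y\<bar> ^ k)
        \<le> norm (2 ^ k * \<bar>c\<bar> ^ k * indicator S y + 2 ^ k * (indicator S y *\<^sub>R \<bar>b y\<bar> ^ k))"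
        by (auto split: split_indicator simp: algebra_simps)
    qed
  qed measurable
qed

text \<open>The sign \<open>s\<close> treats both sides of the median at once. The factor \<open>s ^ k\<close>, of modulus 1, makes
  \<open>(b x - b y) ^ k\<close> nonnegative on the set of integration.\<close>
lemma commutator_lower_bound:
  fixes K :: "(real^'n) \<times> (real^'m) \<Rightarrow> (real^'n) \<times> (real^'m) \<Rightarrow> complex"
  assumes K: "full_kernel \<delta> CK K" and R: "compact R"
    and b: "L_loc k b" "k \<ge> 1" and s: "s = 1 \<or> s = -1"
    and sep: "\<And>v. v \<in> R \<Longrightarrow> fst x \<noteq> fst v \<and> snd x \<noteq> snd v"
    and near: "\<And>v. v \<in> R \<Longrightarrow> norm (K x v - \<kappa>) \<le> norm \<kappa> / 2"
    and x: "s * \<alpha> \<le> s * b x"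
  shows "norm \<kappa> / 2 * (LINT y|lebesgue. indicator R y * (max 0 (s * (\<alpha> - b y))) ^ k)
    \<le> norm (LINT y:{y \<in> R. s * b y \<le> s * \<alpha>}|lebesgue. complex_of_real ((b x - b y) ^ k) * K x y)"
proof -
  define A where "A = {y \<in> R. s * b y \<le> s * \<alpha>}"
  have bm[measurable]: "b \<in> borel_measurable lebesgue" using b by (simp add: L_loc_def)
  have Rm[measurable]: "R \<in> sets lebesgue" using lmeasurable_compact[OF R] by blast
  have "A = R \<inter> {y \<in> space lebesgue. s * b y \<le> s * \<alpha>}" by (auto simp: A_def)
  also have "\<dots> \<in> sets lebesgue" by measurable
  finally have Am[measurable]: "A \<in> sets lebesgue" .
  define \<psi> where "\<psi> y = indicator A y * (s * (b x - b y)) ^ k" for y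
  define k' where "k' y = indicator R y *\<^sub>R K x y" for y
  have nn: "s * (b x - b y) \<ge> 0" if "y \<in> A" for y
    using that x by (auto simp: A_def algebra_simps)
  have \<psi>nn: "\<psi> y \<ge> 0" for y using nn by (auto simp: \<psi>_def split: split_indicator)
  have abs: "\<bar>s * t\<bar> = \<bar>t\<bar>" for t using s by auto
  have int: "integrable lebesgue (\<lambda>y. indicator R y * \<bar>c - b y\<bar> ^ k)" for c
    using L_loc_integrable_power_diff[OF b(1) R] .
  have \<psi>int: "integrable lebesgue \<psi>"
  proof (rule Bochner_Integration.integrable_bound[OF int[of "b x"]])
    show "\<psi> \<in> borel_measurable lebesgue" unfolding \<psi>_def by measurable
    show "AE y in lebesgue. norm (\<psi> y) \<le> norm (indicator R y * \<bar>b x - b y\<bar> ^ k)"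
      by (intro AE_I2) (auto simp: \<psi>_def A_def abs power_abs split: split_indicator simp flip: power_mult_distrib)
  qed
  have "continuous_on R (K x)"
  proof (rule continuous_at_imp_continuous_on, rule ballI)
    fix v assume "v \<in> R"
    then show "isCont (K x) v"
      using full_kernel_isCont[OF K, of "fst x" "fst v" "snd x" "snd v"] sep by simp
  qed
  then have "K x \<in> borel_measurable (lebesgue_on R)"
    using Rm by (rule continuous_imp_measurable_on_sets_lebesgue)
  then have k'm: "k' \<in> borel_measurable lebesgue"
    unfolding k'_def using Rm by (subst (asm) borel_measurable_restrict_space_iff) auto
  have 1: "norm \<kappa> / 2 * (LINT y|lebesgue. \<psi> y) \<le> norm (LINT y|lebesgue. complex_of_real (\<psi> y) * k' y)"
  proof (rule norm_integral_near_constant_ge[OF \<psi>int \<psi>nn k'm])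
    fix y assume "\<psi> y \<noteq> 0"
    then have "y \<in> R" by (auto simp: \<psi>_def A_def split: split_indicator_asm)
    then show "norm (k' y - \<kappa>) \<le> norm \<kappa> / 2" using near by (simp add: k'_def)
  qed
  have "(LINT y|lebesgue. indicator R y * (max 0 (s * (\<alpha> - b y))) ^ k) \<le> (LINT y|lebesgue. \<psi> y)"
  proof (rule integral_mono[OF _ \<psi>int])
    show "integrable lebesgue (\<lambda>y. indicator R y * (max 0 (s * (\<alpha> - b y))) ^ k)"
    proof (rule Bochner_Integration.integrable_bound[OF int[of \<alpha>]])
      show "AE y in lebesgue. norm (indicator R y * max 0 (s * (\<alpha> - b y)) ^ k) \<le> norm (indicator R y * \<bar>\<alpha> - b y\<bar> ^ k)"
      proof (rule AE_I2)
        fix y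
        have "max 0 (s * (\<alpha> - b y)) ^ k \<le> \<bar>\<alpha> - b y\<bar> ^ k"
          using abs[of "\<alpha> - b y"] by (intro power_mono) auto
        then show "norm (indicator R y * max 0 (s * (\<alpha> - b y)) ^ k) \<le> norm (indicator R y * \<bar>\<alpha> - b y\<bar> ^ k)"
          by (auto split: split_indicator)
      qed
    qed measurable
    fix y
    show "indicator R y * max 0 (s * (\<alpha> - b y)) ^ k \<le> \<psi> y"
    proof (cases "y \<in> A")
      case True
      then show ?thesis using x
        by (auto simp: \<psi>_def A_def algebra_simps intro!: power_mono)
    next
      case False
      then have "y \<in> R \<Longrightarrow> max 0 (s * (\<alpha> - b y)) = 0"
        by (auto simp: A_def algebra_simps)
      then show ?thesis using False b(2) \<psi>nn[of y] by (auto split: split_indicator simp: zero_power)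
    qed
  qed
  then have 2: "norm \<kappa> / 2 * (LINT y|lebesgue. indicator R y * (max 0 (s * (\<alpha> - b y))) ^ k)
      \<le> norm \<kappa> / 2 * (LINT y|lebesgue. \<psi> y)"
    by (intro mult_left_mono) auto
  have "(LINT y:A|lebesgue. complex_of_real ((b x - b y) ^ k) * K x y)
      = (LINT y|lebesgue. complex_of_real (s ^ k) * (complex_of_real (\<psi> y) * k' y))"
    unfolding set_lebesgue_integral_def
  proof (intro Bochner_Integration.integral_cong refl)
    fix y
    have "s ^ k * (s * (b x - b y)) ^ k = (b x - b y) ^ k"
      using s by (auto simp flip: power_mult_distrib)
    then have eq: "complex_of_real (s ^ k) * complex_of_real ((s * (b x - b y)) ^ k) = complex_of_real ((b x - b y) ^ k)"
      by (metis of_real_mult)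
    show "indicator A y *\<^sub>R (complex_of_real ((b x - b y) ^ k) * K x y)
       = complex_of_real (s ^ k) * (complex_of_real (\<psi> y) * k' y)"
    proof (cases "y \<in> A")
      case True
      then have "\<psi> y = (s * (b x - b y)) ^ k" "k' y = K x y" by (auto simp: \<psi>_def k'_def A_def)
      then show ?thesis using True unfolding eq[symmetric] by simp
    qed (simp add: \<psi>_def)
  qed
  also have "\<dots> = complex_of_real (s ^ k) * (LINT y|lebesgue. complex_of_real (\<psi> y) * k' y)"
    by (rule integral_mult_right_zero)
  finally have "norm (LINT y:A|lebesgue. complex_of_real ((b x - b y) ^ k) * K x y)
     = norm (LINT y|lebesgue. complex_of_real (\<psi> y) * k' y)"
    using s by (auto simp: norm_mult norm_power)
  then show ?thesis using 1 2 unfolding A_def by linarith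
qed

lemma ennpowr_mono:
  assumes "x \<le> y" "a \<ge> 0"
  shows "ennpowr x a \<le> ennpowr y a"
proof (cases "y = \<infinity>")
  case False
  then have "x \<noteq> \<infinity>" using assms by (auto simp: top_unique)
  then show ?thesis using False assms
    by (auto simp: ennpowr_def intro!: ennreal_leI powr_mono2 enn2real_mono simp: less_top)
qed (simp add: ennpowr_def)

lemma weak_norm_ge:
  assumes "t > 0" "\<And>x. x \<in> E \<Longrightarrow> t < norm (g x)" "weight_measure w E = ennreal V" "V \<ge> 0" "p > 0"
  shows "ennreal (t * V powr (1 / p)) \<le> weak_norm p w g"
proof -
  have "weight_measure w E \<le> weight_measure w {x. norm (g x) > t}"
    unfolding weight_measure_def using assms(2) by (intro nn_integral_mono) (auto split: split_indicator)
  then have "ennpowr (ennreal V) (1 / p) \<le> ennpowr (weight_measure w {x. norm (g x) > t}) (1 / p)"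
    using assms by (intro ennpowr_mono) auto
  then have "ennreal t * ennpowr (ennreal V) (1 / p) \<le> ennreal t * ennpowr (weight_measure w {x. norm (g x) > t}) (1 / p)"
    by (intro mult_left_mono) auto
  also have "\<dots> \<le> weak_norm p w g"
    unfolding weak_norm_def using assms by (intro SUP_upper) auto
  finally show ?thesis using assms by (simp add: ennpowr_ennreal ennreal_mult)
qed

lemma Gamma_const_ge:
  assumes "I \<in> cubes l" "I' \<in> cubes l" "J \<in> cubes r" "J' \<in> cubes r"
    "comparable C0 (setdist I I') l" "comparable C0 (setdist J J') r" "A \<in> sets lebesgue" "A \<subseteq> I \<times> J"
  shows "weak_norm p lam (\<lambda>x. indicator (I' \<times> J') x * (LINT y:A|lebesgue. complex_of_real ((b x - b y) ^ k) * K x y))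
        / ennpowr (weight_measure \<mu> (I \<times> J)) (1 / p) \<le> Gamma_const C0 K b \<mu> lam k p"
  unfolding Gamma_const_def using assms by (intro Sup_upper) blast

text \<open>The pointwise lower bound holds on the whole set where \<open>s * b\<close> is at least \<open>s * \<alpha>\<close>, so every level
  below it contributes the full \<open>\<lambda>\<close>-measure \<open>V\<close> of this set to the weak norm.\<close>
lemma one_sided_oscillation_bound:
  fixes K :: "(real^'n) \<times> (real^'m) \<Rightarrow> (real^'n) \<times> (real^'m) \<Rightarrow> complex"
  assumes K: "full_kernel \<delta> CK K"
    and b: "L_loc k b" "k \<ge> 1" and s: "s = 1 \<or> s = -1" and p: "p > 1"
    and I: "I \<in> cubes l" "I' \<in> cubes l" "J \<in> cubes r" "J' \<in> cubes r"
    "comparable C0 (setdist I I') l" "comparable C0 (setdist J J') r"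
    and sep: "\<And>u v. u \<in> I' \<Longrightarrow> v \<in> I \<Longrightarrow> u \<noteq> v" "\<And>u v. u \<in> J' \<Longrightarrow> v \<in> J \<Longrightarrow> u \<noteq> v"
    and near: "\<And>u v. u \<in> I' \<times> J' \<Longrightarrow> v \<in> I \<times> J \<Longrightarrow> norm (K u v - \<kappa>) \<le> norm \<kappa> / 2"
    and G: "Gamma_const C0 K b \<mu> lam k p = ennreal G" "G \<ge> 0"
    and W: "weight_measure \<mu> (I \<times> J) = ennreal W" "W > 0"
    and V: "weight_measure lam {x \<in> I' \<times> J'. s * \<alpha> \<le> s * b x} = ennreal V" "V > 0"
  shows "norm \<kappa> / 2 * (LINT y|lebesgue. indicator (I \<times> J) y * (max 0 (s * (\<alpha> - b y))) ^ k)
    \<le> G * (W / V) powr (1 / p)" (is "?L \<le> ?U")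
proof (cases "?L > 0")
  case False
  moreover have "?U \<ge> 0" using G by simp
  ultimately show ?thesis by linarith
next
  case True
  have R: "compact (I \<times> J)"
    using I(1,3) unfolding cubes_def by (auto intro!: compact_Times)
  define A where "A = {y \<in> I \<times> J. s * b y \<le> s * \<alpha>}"
  have [measurable]: "b \<in> borel_measurable lebesgue" using b by (simp add: L_loc_def)
  have [measurable]: "I \<times> J \<in> sets lebesgue" using lmeasurable_compact[OF R] by blast
  have "A = (I \<times> J) \<inter> {y \<in> space lebesgue. s * b y \<le> s * \<alpha>}" by (auto simp: A_def)
  also have "\<dots> \<in> sets lebesgue" by measurable
  finally have Am: "A \<in> sets lebesgue" .
  have AR: "A \<subseteq> I \<times> J" by (auto simp: A_def)
  define g where "g x = indicator (I' \<times> J') x * (LINT y:A|lebesgue. complex_of_real ((b x - b y) ^ k) * K x y)" for x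
  have lower: "?L \<le> norm (g x)" if "x \<in> I' \<times> J'" "s * \<alpha> \<le> s * b x" for x
  proof -
    have "?L \<le> norm (LINT y:{y \<in> I \<times> J. s * b y \<le> s * \<alpha>}|lebesgue. complex_of_real ((b x - b y) ^ k) * K x y)"
    proof (rule commutator_lower_bound[OF K R b s _ near that(2)])
      fix v assume "v \<in> I \<times> J"
      then show "fst x \<noteq> fst v \<and> snd x \<noteq> snd v"
        using that(1) sep(1)[of "fst x" "fst v"] sep(2)[of "snd x" "snd v"] by (auto simp: mem_Times_iff)
    qed (use that in auto)
    then show ?thesis using that(1) by (simp add: g_def A_def)
  qed
  have "t \<le> ?U" if t: "0 < t" "t < ?L" for t
  proof -
    have "ennreal (t * V powr (1 / p)) \<le> weak_norm p lam g"
    proof (rule weak_norm_ge[OF t(1) _ V(1)])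
      show "t < norm (g x)" if "x \<in> {x \<in> I' \<times> J'. s * \<alpha> \<le> s * b x}" for x
        using that less_le_trans[OF t(2) lower] by blast
    qed (use V p in auto)
    then have "ennreal (t * V powr (1 / p)) / ennpowr (weight_measure \<mu> (I \<times> J)) (1 / p)
       \<le> weak_norm p lam g / ennpowr (weight_measure \<mu> (I \<times> J)) (1 / p)"
      by (rule divide_right_mono_ennreal)
    also have "\<dots> \<le> ennreal G"
      using Gamma_const_ge[OF I Am AR, of p lam b k K \<mu>] G unfolding g_def by simp
    finally have "ennreal (t * V powr (1 / p) / W powr (1 / p)) \<le> ennreal G"
      using W t by (simp add: ennpowr_ennreal divide_ennreal)
    then have "t * V powr (1 / p) / W powr (1 / p) \<le> G" using G by (simp add: ennreal_le_iff)
    then show ?thesis using W V by (simp add: powr_divide field_simps)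
  qed
  then show ?thesis by (rule dense_le_bounded[OF True])
qed

text \<open>One factor 2 in the constant comes from adding the two sides of the median, one from the median
  splitting the companion rectangle in halves, and one from the kernel being at least half of \<open>\<kappa>\<close>;
  the big rectangle containing both has sides \<open>2 D A + 1\<close> times those of \<open>R\<close>.\<close>
lemma power_oscillation_bound:
  fixes K :: "(real^'n) \<times> (real^'m) \<Rightarrow> (real^'n) \<times> (real^'m) \<Rightarrow> complex"
  defines "S \<equiv> real (CARD('n) + CARD('m))"
  defines "d \<equiv> CARD('n) + CARD('m)"
  assumes K: "full_kernel \<delta> CK K" "uniformly_nondegenerate cK K"
    and D: "D \<ge> 1" "CK \<le> D * cK"
    and A: "A \<ge> 4 * S" "(2 * S / A) powr \<delta> * (8 * D * 2 ^ d) \<le> 1"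
    and b: "L_loc k b" "k \<ge> 1" and p: "p > 1" and w: "\<mu> \<in> Ap p" "lam \<in> Ap p"
    and M: "Ap_char p lam \<le> ennreal M" "M > 0"
    and G: "Gamma_const (D * A) K b \<mu> lam k p = ennreal G" "G \<ge> 0"
    and R: "R \<in> rectangles"
    and W: "weight_measure \<mu> R = ennreal W" "W > 0"
    and L: "weight_measure lam R = ennreal L" "L > 0"
  obtains \<alpha> where "(\<integral>\<^sup>+y\<in>R. ennreal (\<bar>b y - \<alpha>\<bar> ^ k) \<partial>lebesgue)
    \<le> ennreal (8 * (A * (2 * (D * A) + 1)) ^ d * M powr (1 / p) / cK * G * measure lebesgue R * (W / L) powr (1 / p))"
proof -
  obtain a1 :: "real^'n" and a2 :: "real^'m" and l r where Req: "R = cbox a1 (a1 + vec l) \<times> cbox a2 (a2 + vec r)"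
    and lr: "l > 0" "r > 0" using rectanglesE[OF R] .
  have S: "real CARD('n) \<ge> 1" "real CARD('m) \<ge> 1" "S = real CARD('n) + real CARD('m)"
    unfolding S_def using zero_less_card_finite[where 'a='n] zero_less_card_finite[where 'a='m] by linarith+
  then have A1: "A \<ge> 1" "A \<ge> 2 * real CARD('n) + 1" "A \<ge> 2 * real CARD('m) + 1" using A(1) by linarith+
  define B where "B = D * A"
  have B1: "B \<ge> 1" unfolding B_def using A1 D mult_mono[of 1 D 1 A] by simp
  have cK: "cK > 0" using K(2) by (simp add: uniformly_nondegenerate_def)
  obtain x1 x2 where x: "A * l < norm (x1 - a1)" "norm (x1 - a1) \<le> D * A * l"
    "A * r < norm (x2 - a2)" "norm (x2 - a2) \<le> D * A * r"
    and big: "cK / ((A * l) ^ CARD('n) * (A * r) ^ CARD('m)) \<le> norm (K (x1, x2) (a1, a2))"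
    and near: "\<And>u v. u \<in> cbox x1 (x1 + vec l) \<times> cbox x2 (x2 + vec r) \<Longrightarrow>
       v \<in> cbox a1 (a1 + vec l) \<times> cbox a2 (a2 + vec r) \<Longrightarrow>
       norm (K u v - K (x1, x2) (a1, a2)) \<le> norm (K (x1, x2) (a1, a2)) / 2"
    by (rule nondegenerate_companion[OF K D A[unfolded S_def d_def] lr, of a1 a2]) blast
  note x = x[folded B_def]
  define \<kappa> where "\<kappa> = K (x1, x2) (a1, a2)"
  define R' where "R' = cbox x1 (x1 + vec l) \<times> cbox x2 (x2 + vec r)"
  define Q where "Q = cbox (a1 - vec (B * l)) (a1 - vec (B * l) + vec ((2 * B + 1) * l))
     \<times> cbox (a2 - vec (B * r)) (a2 - vec (B * r) + vec ((2 * B + 1) * r))"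
  have R': "R' \<in> rectangles" unfolding R'_def using lr by (rule rectangleI)
  have Q: "Q \<in> rectangles" unfolding Q_def using lr B1 by (intro rectangleI) auto
  have sub: "R \<subseteq> Q" "R' \<subseteq> Q"
    unfolding Req R'_def Q_def using x lr B1 by (intro Sigma_mono cubes_subset_common_cube; simp)+
  define m where "m = measure lebesgue R"
  have m: "m = l ^ CARD('n) * r ^ CARD('m)" unfolding m_def Req using lr by (rule measure_rectangle)
  have m': "measure lebesgue R' = m" unfolding m R'_def using lr by (rule measure_rectangle)
  have mQ: "measure lebesgue Q = (2 * B + 1) ^ d * m"
    unfolding m Q_def d_def using lr B1 by (subst measure_rectangle) (auto simp: power_mult_distrib power_add)
  have mpos: "m > 0" unfolding m using lr by simp
  have \<kappa>: "cK / (A ^ d * m) \<le> norm \<kappa>"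
    using big unfolding \<kappa>_def m d_def by (simp add: power_mult_distrib power_add mult_ac)
  have bm[measurable]: "b \<in> borel_measurable lebesgue" using b by (simp add: L_loc_def)
  note R'p = rectangle_props[OF R'] and Rp = rectangle_props[OF R] and Qp = rectangle_props[OF Q]
  note [measurable] = R'p(2) Rp(2)
  obtain \<alpha> where med: "measure lebesgue R' / 2 \<le> measure lebesgue {x \<in> R'. b x \<le> \<alpha>}"
    "measure lebesgue R' / 2 \<le> measure lebesgue {x \<in> R'. \<alpha> \<le> b x}"
    using ex_median[OF R'p(3) bm] .
  define X where "X s = (LINT y|lebesgue. indicator R y * (max 0 (s * (\<alpha> - b y))) ^ k)" for s
  define H where "H = 4 * (A * (2 * B + 1)) ^ d * M powr (1 / p) / cK * G * m * (W / L) powr (1 / p)"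
  have half: "X s \<le> H" if s: "s = 1 \<or> s = -1" for s
  proof -
    define E where "E = {x \<in> R'. s * \<alpha> \<le> s * b x}"
    have Em: "E \<in> sets lebesgue"
    proof -
      have "E = R' \<inter> {y \<in> space lebesgue. s * \<alpha> \<le> s * b y}" by (auto simp: E_def)
      also have "\<dots> \<in> sets lebesgue" by measurable
      finally show ?thesis .
    qed
    have Eh: "m / 2 \<le> measure lebesgue E" using med s m' by (auto simp: E_def)
    have EQ: "E \<subseteq> Q" using sub by (auto simp: E_def)
    obtain V where V: "V > 0" "weight_measure lam E = ennreal V"
      using weight_measure_finite_pos[OF _ EQ Qp(1) Em, of lam] w(2) Eh mpos by (auto simp: Ap_def)
    have "L * (m / 2) powr p \<le> L * measure lebesgue E powr p"
      using L Eh mpos p by (intro mult_left_mono powr_mono2) auto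
    also have "\<dots> \<le> M * measure lebesgue Q powr p * V"
      using Ap_subset_bound[OF w(2) p Q M Em EQ V(2,1) sub(1) L] .
    finally have "L * (m / 2) powr p \<le> M * ((2 * B + 1) ^ d * m) powr p * V" unfolding mQ .
    moreover have "((2 * B + 1) ^ d * m) powr p = (2 * (2 * B + 1) ^ d) powr p * (m / 2) powr p"
      using B1 mpos by (simp flip: powr_mult)
    ultimately have "L * (m / 2) powr p \<le> (M * (2 * (2 * B + 1) ^ d) powr p * V) * (m / 2) powr p"
      by (simp add: mult_ac)
    then have "L \<le> M * (2 * (2 * B + 1) ^ d) powr p * V" using mpos by simp
    then have "W * L \<le> W * (M * (2 * (2 * B + 1) ^ d) powr p * V)" using W by (intro mult_left_mono) auto
    then have "W / V \<le> M * (2 * (2 * B + 1) ^ d) powr p * (W / L)"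
      using L V by (simp add: field_simps)
    then have "(W / V) powr (1 / p) \<le> (M * (2 * (2 * B + 1) ^ d) powr p * (W / L)) powr (1 / p)"
      using W V p by (intro powr_mono2) auto
    also have "\<dots> = M powr (1 / p) * (2 * (2 * B + 1) ^ d) * (W / L) powr (1 / p)"
    proof -
      have "(M * c powr p * t) powr (1 / p) = M powr (1 / p) * c * t powr (1 / p)"
        if "c > 0" "t > 0" for c t
        using that M p by (simp add: powr_mult powr_powr)
      from this[of "2 * (2 * B + 1) ^ d" "W / L"] show ?thesis using W L B1 by simp
    qed
    finally have WV: "(W / V) powr (1 / p) \<le> M powr (1 / p) * (2 * (2 * B + 1) ^ d) * (W / L) powr (1 / p)" .
    have Xnn: "X s \<ge> 0" unfolding X_def by (intro integral_nonneg_AE AE_I2) auto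
    have "norm \<kappa> / 2 * X s \<le> G * (W / V) powr (1 / p)"
      unfolding X_def Req
    proof (rule one_sided_oscillation_bound[OF K(1) b s p])
      show "cbox a1 (a1 + vec l) \<in> cubes l" "cbox x1 (x1 + vec l) \<in> cubes l"
        "cbox a2 (a2 + vec r) \<in> cubes r" "cbox x2 (x2 + vec r) \<in> cubes r"
        using lr by (auto simp: cubes_def)
      show "comparable B (setdist (cbox a1 (a1 + vec l)) (cbox x1 (x1 + vec l))) l"
        using A1 lr x B1 by (intro setdist_companion_cube(1)[where A = A])
      show "comparable B (setdist (cbox a2 (a2 + vec r)) (cbox x2 (x2 + vec r))) r"
        using A1 lr x B1 by (intro setdist_companion_cube(1)[where A = A])
      show "u \<noteq> v" if "u \<in> cbox x1 (x1 + vec l)" "v \<in> cbox a1 (a1 + vec l)" for u v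
        using setdist_companion_cube(2)[OF A1(2) lr(1) x(1,2) B1 that] .
      show "u \<noteq> v" if "u \<in> cbox x2 (x2 + vec r)" "v \<in> cbox a2 (a2 + vec r)" for u v
        using setdist_companion_cube(2)[OF A1(3) lr(2) x(3,4) B1 that] .
      show "Gamma_const B K b \<mu> lam k p = ennreal G" using G by (simp add: B_def)
      show "weight_measure lam {x \<in> cbox x1 (x1 + vec l) \<times> cbox x2 (x2 + vec r). s * \<alpha> \<le> s * b x} = ennreal V"
        using V by (simp add: E_def R'_def)
    qed (use near G W V Req in \<open>auto simp: \<kappa>_def\<close>)
    also have "\<dots> \<le> G * (M powr (1 / p) * (2 * (2 * B + 1) ^ d) * (W / L) powr (1 / p))"
      using WV G by (intro mult_left_mono)
    finally have "norm \<kappa> / 2 * X s \<le> G * (M powr (1 / p) * (2 * (2 * B + 1) ^ d) * (W / L) powr (1 / p))" .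
    moreover have "cK / (A ^ d * m) / 2 * X s \<le> norm \<kappa> / 2 * X s"
      using \<kappa> Xnn by (intro mult_right_mono divide_right_mono) auto
    ultimately have "cK / (A ^ d * m) / 2 * X s \<le> G * (M powr (1 / p) * (2 * (2 * B + 1) ^ d) * (W / L) powr (1 / p))"
      by linarith
    then have "cK / (A ^ d * m) / 2 * X s * (2 * A ^ d * m / cK)
       \<le> G * (M powr (1 / p) * (2 * (2 * B + 1) ^ d) * (W / L) powr (1 / p)) * (2 * A ^ d * m / cK)"
      using cK mpos A1 by (intro mult_right_mono) auto
    moreover have "cK / (A ^ d * m) / 2 * X s * (2 * A ^ d * m / cK) = X s"
      using cK mpos A1 by simp
    moreover have "G * (M powr (1 / p) * (2 * (2 * B + 1) ^ d) * (W / L) powr (1 / p)) * (2 * A ^ d * m / cK) = H"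
      by (simp add: H_def power_mult_distrib)
    ultimately show ?thesis by simp
  qed
  have int: "integrable lebesgue (\<lambda>y. indicator R y * (max 0 (s * (\<alpha> - b y))) ^ k)" if "s = 1 \<or> s = -1" for s
  proof (rule Bochner_Integration.integrable_bound[OF L_loc_integrable_power_diff[OF b(1) Rp(1), of \<alpha>]])
    have "max 0 (s * (\<alpha> - b y)) ^ k \<le> \<bar>\<alpha> - b y\<bar> ^ k" for y
      using that by (intro power_mono) auto
    then show "AE y in lebesgue. norm (indicator R y * max 0 (s * (\<alpha> - b y)) ^ k) \<le> norm (indicator R y * \<bar>\<alpha> - b y\<bar> ^ k)"
      by (intro AE_I2) (auto split: split_indicator)
  qed measurable
  have "(\<integral>\<^sup>+y\<in>R. ennreal (\<bar>b y - \<alpha>\<bar> ^ k) \<partial>lebesgue)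
    = (\<integral>\<^sup>+y. ennreal (indicator R y * (max 0 (1 * (\<alpha> - b y))) ^ k) + ennreal (indicator R y * (max 0 ((- 1) * (\<alpha> - b y))) ^ k) \<partial>lebesgue)"
  proof (intro nn_integral_cong)
    fix y
    have "\<bar>b y - \<alpha>\<bar> ^ k = max 0 (1 * (\<alpha> - b y)) ^ k + max 0 ((- 1) * (\<alpha> - b y)) ^ k"
      using b(2) by (cases "\<alpha> \<le> b y") (auto simp: max_def zero_power)
    then show "ennreal (\<bar>b y - \<alpha>\<bar> ^ k) * indicator R y = ennreal (indicator R y * (max 0 (1 * (\<alpha> - b y))) ^ k) + ennreal (indicator R y * (max 0 ((- 1) * (\<alpha> - b y))) ^ k)"
      by (auto split: split_indicator simp flip: ennreal_plus)
  qed
  also have "\<dots> = ennreal (X 1) + ennreal (X (- 1))"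
    unfolding X_def using int[of 1] int[of "-1"]
    by (subst nn_integral_add) (auto simp: nn_integral_eq_integral)
  also have "\<dots> \<le> ennreal H + ennreal H" using half by (intro add_mono ennreal_leI) auto
  also have "\<dots> = ennreal (2 * H)"
    using M G mpos cK A1 B1 by (subst ennreal_plus[symmetric]) (auto simp: H_def)
  also have "2 * H = 8 * (A * (2 * (D * A) + 1)) ^ d * M powr (1 / p) / cK * G * measure lebesgue R * (W / L) powr (1 / p)"
    by (simp add: H_def B_def m_def)
  finally show ?thesis by (rule that)
qed

section \<open>The oscillation over a fixed rectangle and the main estimate\<close>

text \<open>The \<open>\<mu>(R) / \<lambda>(R)\<close> left over by the power mean inequality is exactly what
  \<open>Ap_bloom_ratio_bound\<close> absorbs into the integral of \<open>\<nu>^(1/k)\<close>.\<close>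
lemma bmo_quotient_bound:
  fixes K :: "(real^'n) \<times> (real^'m) \<Rightarrow> (real^'n) \<times> (real^'m) \<Rightarrow> complex"
  defines "d \<equiv> CARD('n) + CARD('m)"
  assumes K: "full_kernel \<delta> CK K" "uniformly_nondegenerate cK K"
    and D: "D \<ge> 1" "CK \<le> D * cK"
    and A: "A \<ge> 4 * real d" "(2 * real d / A) powr \<delta> * (8 * D * 2 ^ d) \<le> 1"
    and b: "L_loc k b" "k \<ge> 1" and p: "p > 1" and w: "\<mu> \<in> Ap p" "lam \<in> Ap p"
    and M: "Ap_char p \<mu> \<le> ennreal M" "M > 0" and N: "Ap_char p lam \<le> ennreal N" "N > 0"
    and G: "Gamma_const (D * A) K b \<mu> lam k p = ennreal G" "G \<ge> 0"
    and R: "R \<in> rectangles"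
  shows "(\<integral>\<^sup>+x\<in>R. ennreal \<bar>b x - average b R\<bar> \<partial>lebesgue)
      / weight_measure (\<lambda>x. (\<mu> x powr (1 / p) * lam x powr (- 1 / p)) powr (1 / real k)) R
    \<le> ennreal (2 * M powr (1 / (p * real k))
        * (8 * (A * (2 * (D * A) + 1)) ^ d * N powr (1 / p) / cK) powr (1 / real k) * G powr (1 / real k))"
    (is "?osc / weight_measure ?\<nu> R \<le> ennreal ?C")
proof -
  note Rp = rectangle_props[OF R]
  define m where "m = measure lebesgue R"
  have m: "m > 0" "emeasure lebesgue R = ennreal m" using Rp by (auto simp: m_def)
  have d: "d \<ge> 1" using zero_less_card_finite[where 'a='n] unfolding d_def by linarith
  have Apos: "A > 0" using A(1) d by (smt (verit) of_nat_1 of_nat_mono)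
  have cK: "cK > 0" using K(2) by (simp add: uniformly_nondegenerate_def)
  have wt: "weight \<mu>" "weight lam" using w by (auto simp: Ap_def)
  then have meas[measurable]: "\<mu> \<in> borel_measurable lebesgue" "lam \<in> borel_measurable lebesgue"
    and wpos: "AE x in lebesgue. \<mu> x > 0" "AE x in lebesgue. lam x > 0"
    by (auto simp: weight_def L_loc_def)
  have bm: "b \<in> borel_measurable lebesgue" using b by (simp add: L_loc_def)
  obtain W where W: "W > 0" "weight_measure \<mu> R = ennreal W"
    using weight_measure_finite_pos[OF wt(1) order_refl] Rp by blast
  obtain L where L: "L > 0" "weight_measure lam R = ennreal L"
    using weight_measure_finite_pos[OF wt(2) order_refl] Rp by blast
  define H where "H = 8 * (A * (2 * (D * A) + 1)) ^ d * N powr (1 / p) / cK"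
  have H: "H > 0" unfolding H_def using Apos D N cK by (auto intro!: divide_pos_pos mult_pos_pos zero_less_power add_pos_pos)
  define F where "F = H * G * m * (W / L) powr (1 / p)"
  have F: "F \<ge> 0" unfolding F_def using H G m by simp
  obtain \<alpha> where \<alpha>: "(\<integral>\<^sup>+y\<in>R. ennreal (\<bar>b y - \<alpha>\<bar> ^ k) \<partial>lebesgue) \<le> ennreal F"
    using power_oscillation_bound[OF K D A[unfolded d_def] b p w N G R W(2,1) L(2,1)]
    unfolding F_def H_def d_def m_def by blast
  define T where "T = F powr (1 / real k) * m powr (1 - 1 / real k)"
  have "(\<integral>\<^sup>+y\<in>R. ennreal \<bar>b y - \<alpha>\<bar> \<partial>lebesgue) \<le> ennreal T"
    unfolding T_def using bm b(2) \<alpha> F m Rp by (intro set_nn_integral_power_mean) auto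
  then have osc: "?osc \<le> ennreal (2 * T)"
    using bm m Rp by (intro mean_oscillation_le[where m = m and \<alpha> = \<alpha>]) (auto simp: T_def)
  have T: "T = H powr (1 / real k) * G powr (1 / real k) * ((W / L) powr (1 / (p * real k)) * m)"
  proof -
    have "m powr (1 / real k) * m powr (1 - 1 / real k) = m" using m by (simp flip: powr_add)
    moreover have "F powr (1 / real k) = H powr (1 / real k) * G powr (1 / real k) * m powr (1 / real k) * (W / L) powr (1 / (p * real k))"
      unfolding F_def using H G m W L by (simp add: powr_mult powr_powr)
    ultimately show ?thesis unfolding T_def by (simp add: mult_ac)
  qed
  show ?thesis
  proof (cases "weight_measure ?\<nu> R = \<infinity>")
    case True
    have "?osc < \<infinity>" using osc by (auto intro: le_less_trans)
    then show ?thesis using True by (simp add: divide_ennreal_def)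
  next
    case False
    have "weight_measure ?\<nu> R > 0"
      unfolding weight_measure_def
    proof (rule set_nn_integral_pos)
      show "AE x in lebesgue. 0 < ?\<nu> x" using wpos by eventually_elim auto
      show "?\<nu> \<in> borel_measurable lebesgue" by measurable
    qed (use Rp m in auto)
    with False obtain V where V: "weight_measure ?\<nu> R = ennreal V" "V > 0"
      by (cases "weight_measure ?\<nu> R") (auto simp: ennreal_less_zero_iff)
    have key: "(W / L) powr (1 / (p * real k)) * m \<le> M powr (1 / (p * real k)) * V"
      unfolding m_def using Ap_bloom_ratio_bound[OF w(1) wt(2) p b(2) R M W(2,1) L(2,1) V] .
    have "T \<le> H powr (1 / real k) * G powr (1 / real k) * (M powr (1 / (p * real k)) * V)"
      unfolding T using key by (intro mult_left_mono) auto
    then have C: "2 * T / V \<le> ?C"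
      unfolding H_def[symmetric] using V by (simp add: divide_le_eq mult_ac)
    have "?osc / ennreal V \<le> ennreal (2 * T) / ennreal V"
      using osc by (rule divide_right_mono_ennreal)
    also have "\<dots> = ennreal (2 * T / V)"
      using V by (intro divide_ennreal) (auto simp: T_def)
    also have "\<dots> \<le> ennreal ?C" using C by (rule ennreal_leI)
    finally show ?thesis unfolding V(1) .
  qed
qed

theorem proposition5p2:
  fixes \<delta> CK cK :: real
  shows "\<exists>C0\<ge>1. \<exists>C :: real \<Rightarrow> nat \<Rightarrow> ennreal \<Rightarrow> ennreal \<Rightarrow> real.
    (\<forall>p k M N. C p k M N > 0) \<and>
    (\<forall>(K :: (real^'n) \<times> (real^'m) \<Rightarrow> (real^'n) \<times> (real^'m) \<Rightarrow> complex) (k::nat)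
       (b :: (real^'n) \<times> (real^'m) \<Rightarrow> real) (p::real)
       (\<mu> :: (real^'n) \<times> (real^'m) \<Rightarrow> real) (lam :: (real^'n) \<times> (real^'m) \<Rightarrow> real).
       full_kernel \<delta> CK K \<longrightarrow> uniformly_nondegenerate cK K \<longrightarrow>
       k \<ge> 1 \<longrightarrow> L_loc k b \<longrightarrow> p > 1 \<longrightarrow> \<mu> \<in> Ap p \<longrightarrow> lam \<in> Ap p \<longrightarrow>
       (let \<nu> = (\<lambda>x. \<mu> x powr (1 / p) * lam x powr (- 1 / p))
        in bmo_norm (\<lambda>x. \<nu> x powr (1 / real k)) b
             \<le> ennreal (C p k (Ap_char p \<mu>) (Ap_char p lam))
                * ennpowr (Gamma_const C0 K b \<mu> lam k p) (1 / real k)))"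
proof (cases "cK > 0 \<and> \<delta> > 0")
  \<comment> \<open>Otherwise there is no kernel with these constants.\<close>
  case False
  then show ?thesis
    by (intro exI[of _ 1] conjI exI[of _ "\<lambda>_ _ _ _. 1"])
      (auto simp: full_kernel_def uniformly_nondegenerate_def)
next
  case True
  then have cK: "cK > 0" and \<delta>: "\<delta> > 0" by auto
  define d where "d = CARD('n) + CARD('m)"
  have d: "real d \<ge> 1" using zero_less_card_finite[where 'a='n] unfolding d_def by linarith
  \<comment> \<open>The companion point lies within \<open>D A\<close> side lengths, which is why \<open>D A\<close> serves as comparability
    constant.\<close>
  define D where "D = max 1 (CK / cK)"
  have D: "D \<ge> 1" "CK \<le> D * cK" using cK by (auto simp: D_def simp flip: pos_divide_le_eq)
  obtain A where A: "A \<ge> 4 * real d" "(2 * real d / A) powr \<delta> * (8 * D * 2 ^ d) \<le> 1"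
    using ex_large_ratio[of "real d" \<delta> "8 * D * 2 ^ d"] d \<delta> D by auto
  have A1: "A \<ge> 1" using A(1) d by linarith
  have DA: "D * A \<ge> 1" using mult_mono[of 1 D 1 A] D A1 by simp
  define C :: "real \<Rightarrow> nat \<Rightarrow> ennreal \<Rightarrow> ennreal \<Rightarrow> real"
    \<comment> \<open>The maxima with 1 keep \<open>C\<close> positive for arguments that are not characteristics of weights.\<close>
    where "C p k M N = 2 * max 1 (enn2real M) powr (1 / (p * real k))
      * (8 * (A * (2 * (D * A) + 1)) ^ d * max 1 (enn2real N) powr (1 / p) / cK) powr (1 / real k)" for p k M N
  have base: "8 * (A * (2 * (D * A) + 1)) ^ d * max 1 (enn2real N) powr (1 / p) / cK > 0" for N p
    using A1 DA cK by (intro divide_pos_pos mult_pos_pos zero_less_power) auto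
  have Cpos: "C p k M N > 0" for p k M N
  proof -
    have "(8 * (A * (2 * (D * A) + 1)) ^ d * max 1 (enn2real N) powr (1 / p) / cK) powr (1 / real k) > 0"
      using base[of N p] by (metis less_irrefl powr_gt_zero)
    then show ?thesis unfolding C_def by (intro mult_pos_pos) auto
  qed
  show ?thesis
  proof (intro exI[of _ "D * A"] conjI exI[of _ C] allI impI DA Cpos)
    fix K :: "(real^'n) \<times> (real^'m) \<Rightarrow> (real^'n) \<times> (real^'m) \<Rightarrow> complex" and k :: nat
      and b \<mu> lam :: "(real^'n) \<times> (real^'m) \<Rightarrow> real" and p :: real
    assume K: "full_kernel \<delta> CK K" "uniformly_nondegenerate cK K" and k: "k \<ge> 1" and b: "L_loc k b"
      and p: "p > 1" and w: "\<mu> \<in> Ap p" "lam \<in> Ap p"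
    define \<Gamma> where "\<Gamma> = Gamma_const (D * A) K b \<mu> lam k p"
    have "bmo_norm (\<lambda>x. (\<mu> x powr (1 / p) * lam x powr (- 1 / p)) powr (1 / real k)) b
      \<le> ennreal (C p k (Ap_char p \<mu>) (Ap_char p lam)) * ennpowr \<Gamma> (1 / real k)"
    proof (cases "\<Gamma> = \<infinity>")
      case True
      then show ?thesis using Cpos[of p k "Ap_char p \<mu>" "Ap_char p lam"]
        by (simp add: ennpowr_def ennreal_mult_top)
    next
      case False
      define G where "G = enn2real \<Gamma>"
      have G: "\<Gamma> = ennreal G" "G \<ge> 0" using False by (auto simp: G_def less_top)
      have le: "Ap_char p v \<le> ennreal (max 1 (enn2real (Ap_char p v)))" if "v \<in> Ap p"
        for v :: "(real^'n) \<times> (real^'m) \<Rightarrow> real"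
      proof -
        have "Ap_char p v = ennreal (enn2real (Ap_char p v))" using that by (simp add: Ap_def)
        also have "\<dots> \<le> ennreal (max 1 (enn2real (Ap_char p v)))" by (intro ennreal_leI) simp
        finally show ?thesis .
      qed
      have "bmo_norm (\<lambda>x. (\<mu> x powr (1 / p) * lam x powr (- 1 / p)) powr (1 / real k)) b
        \<le> ennreal (C p k (Ap_char p \<mu>) (Ap_char p lam) * G powr (1 / real k))"
        unfolding bmo_norm_def C_def
        using bmo_quotient_bound[OF K D A[unfolded d_def] b k p w le[OF w(1)] _ le[OF w(2)] _ G[unfolded \<Gamma>_def]]
        by (intro SUP_least) (auto simp: d_def)
      also have "\<dots> = ennreal (C p k (Ap_char p \<mu>) (Ap_char p lam)) * ennpowr \<Gamma> (1 / real k)"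
        using G Cpos[of p k "Ap_char p \<mu>" "Ap_char p lam"] by (simp add: ennpowr_ennreal ennreal_mult)
      finally show ?thesis .
    qed
    then show "let \<nu> = (\<lambda>x. \<mu> x powr (1 / p) * lam x powr (- 1 / p))
        in bmo_norm (\<lambda>x. \<nu> x powr (1 / real k)) b
             \<le> ennreal (C p k (Ap_char p \<mu>) (Ap_char p lam))
                * ennpowr (Gamma_const (D * A) K b \<mu> lam k p) (1 / real k)"
      by (simp add: \<Gamma>_def Let_def)
  qed
qed

end
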